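(* Let $\mathcal{P}=(P,\{\,,\,\})$, $P=P_0\ltimes P_1$, be an admissible Poisson algebra with corresponding Poisson triple $([\,,\,]_1,\mathcal{D},\mathcal{K})$. The Lie algebra of all Hamiltonian derivations of $\mathcal{P}$ is $$\mathrm{Ham}(\mathcal{P})=\left\{X_{h\oplus\eta}=\begin{pmatrix}\mathrm{ad}^0_h & 0 \\ \mathscr{T}_{h\oplus\eta} & \mathcal{D}_{dh}+\mathrm{ad}_\eta\end{pmatrix}\ \middle|\ h\oplus\eta\in P\right\}.$$ Moreover: (1) the map $h\oplus\eta\mapsto X_{h\oplus\eta}$ is a Lie algebra homomorphism, whose kernel consists of all Casimir elements of $\mathcal{P}$: $$\mathrm{Casim}(\mathcal{P})=\{k\oplus\zeta\in P\mid k\in\mathrm{Casim}(\mathcal{P}_0),\ k\oplus\zeta\in\ker\mathscr{T}\ \text{and}\ \mathcal{D}_{dk}+\mathrm{ad}_\zeta=0\};$$ (2) a Hamiltonian derivation $X_{h\oplus\eta}$ of $\mathcal{P}$ preserves the commutative algebra $P_0$, i.e. $X_{h\oplus\eta}(P_0\oplus\{0\})\subseteq P_0\oplus\{0\}$, if and only if $h\oplus\eta\in\ker\mathscr{T}$; (3) the set of all $P_0$-preserving Hamiltonian derivations of $\mathcal{P}$, $$\mathrm{Ham}_0(\mathcal{P})=\left\{\begin{pmatrix}\mathrm{ad}^0_h & 0 \\ 0 & \mathcal{D}_{dh}+\mathrm{ad}_\eta\end{pmatrix}\ \middle|\ h\oplus\eta\in\ker\mathscr{T}\right\},$$ is a Lie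 subalgebra of $\mathrm{Ham}(\mathcal{P})$.
   Context: Let $R$ be a commutative ring with unit, $\mathcal{P}_0=(P_0,\cdot,\{\,,\,\}_0)$ a Poisson $R$-algebra (commutative associative unital $R$-algebra with an $R$-bilinear Lie bracket that is a derivation in each argument), $P_1$ a faithful $P_0$-module, and $P=P_0\ltimes P_1$ the $R$-module $P_0\oplus P_1$ with product $(f\oplus\eta)(g\oplus\xi)=fg\oplus(f\xi+g\eta)$. An admissible Poisson structure on $P$ is a Poisson structure with $\mathrm{pr}_0\{f\oplus\eta,g\oplus\xi\}=\{f,g\}_0$; $(P,\{\,,\,\})$ is then an admissible Poisson algebra. $\Omega^1_{P_0}$ is the module of Kähler differentials of $P_0$ over $R$ with universal derivation $d$, anchor $\varrho_{P_0}(dh)=\{h,\cdot\}_0$ (extended $P_0$-linearly). A contravariant derivative on $P_1$ is an $R$-bilinear map $\mathcal{D}:\Omega^1_{P_0}\times P_1\to P_1$ with $\mathcal{D}_{f\alpha}\eta=f\mathcal{D}_\alpha\eta$, $\mathcal{D}_\alpha(f\eta)=f\mathcal{D}_\alpha\eta+\varrho_{P_0}(\alpha)(f)\eta$. Every admissible Poisson algebra has a unique corresponding Poisson triple $([\,,\,]_1,\mathcal{D},\mathcal{K})$, where $[\,,\,]_1$ is a $P_0$-linear Lie bracket on $P_1$, $\mathcal{D}$ a contravariant derivative on $P_1$, and $\mathcal{K}:\Omega^1_{P_0}\times\Omega^1_{P_0}\to P_1$ a $P_0$-bilinear skew-symmetric map, such that $\{f\oplus\eta,g\oplus\xi\}=\{f,g\}_0\oplus(\mathcal{D}_{df}\xi-\mathcal{D}_{dg}\eta+[\eta,\xi]_1+\mathcal{K}(df,dg))$.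 An $R$-linear $X:P\to P$ is written as the matrix $\begin{pmatrix} X_{00} & X_{01} \\ X_{10} & X_{11}\end{pmatrix}$, $X_{ij}:P_j\to P_i$, with $X(f\oplus\eta)=(X_{00}f+X_{01}\eta)\oplus(X_{10}f+X_{11}\eta)$. A Hamiltonian derivation of $\mathcal{P}$ is a map $\{\pi,\cdot\}$, $\pi\in P$; the Lie bracket of derivations is the commutator. A Casimir element $k$ of a Poisson algebra satisfies $\{k,a\}=0$ for all $a$; $\mathrm{Casim}(\cdot)$ is the set of them. $\mathrm{ad}^0_h=\{h,\cdot\}_0$, $\mathrm{ad}_\eta=[\eta,\cdot]_1$, $\mathscr{T}_{h\oplus\eta}:P_0\to P_1$, $\mathscr{T}_{h\oplus\eta}(g)=\mathcal{K}(dh,dg)-\mathcal{D}_{dg}\eta$, and $\ker\mathscr{T}=\{h\oplus\eta\in P\mid\mathscr{T}_{h\oplus\eta}=0\}$. *)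

theory Defs
  imports "HOL-Algebra.Module" "HOL-Algebra.AbelCoset"
begin

section \<open>Modules, Lie algebras, derivations\<close>

text \<open>
  A commutative associative unital \<open>R\<close>-algebra is \<^locale>\<open>algebra\<close> from HOL-Algebra; modules are
  records whose \<open>mult\<close> and \<open>one\<close> fields are irrelevant. All structures have explicit carriers,
  and the zero ring is allowed.
\<close>

definition linear_map ::
    "('r, _) ring_scheme \<Rightarrow> ('r, 'm, _) module_scheme \<Rightarrow> ('r, 'n, _) module_scheme \<Rightarrow> ('m \<Rightarrow> 'n) \<Rightarrow> bool" where
  "linear_map R M N \<phi> \<longleftrightarrow>
     \<phi> \<in> carrier M \<rightarrow> carrier N \<and>
     (\<forall>x\<in>carrier M. \<forall>y\<in>carrier M. \<phi> (x \<oplus>\<^bsub>M\<^esub> y) = \<phi> x \<oplus>\<^bsub>N\<^esub> \<phi> y) \<and>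
     (\<forall>r\<in>carrier R. \<forall>x\<in>carrier M. \<phi> (r \<odot>\<^bsub>M\<^esub> x) = r \<odot>\<^bsub>N\<^esub> \<phi> x)"

definition bilinear_map ::
    "('r, _) ring_scheme \<Rightarrow> ('r, 'm, _) module_scheme \<Rightarrow> ('r, 'n, _) module_scheme \<Rightarrow>
     ('r, 'q, _) module_scheme \<Rightarrow> ('m \<Rightarrow> 'n \<Rightarrow> 'q) \<Rightarrow> bool" where
  "bilinear_map R M N Q b \<longleftrightarrow>
     (\<forall>x\<in>carrier M. linear_map R N Q (b x)) \<and>
     (\<forall>y\<in>carrier N. linear_map R M Q (\<lambda>x. b x y))"

definition faithful_module :: "('a, _) ring_scheme \<Rightarrow> ('a, 'm, _) module_scheme \<Rightarrow> bool" where
  "faithful_module A M \<longleftrightarrow>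
     module A M \<and>
     (\<forall>f\<in>carrier A. (\<forall>x\<in>carrier M. f \<odot>\<^bsub>M\<^esub> x = \<zero>\<^bsub>M\<^esub>) \<longrightarrow> f = \<zero>\<^bsub>A\<^esub>)"

text \<open>The \<open>R\<close>-module underlying a module \<open>M\<close> over an \<open>R\<close>-algebra \<open>A\<close>: \<open>r \<cdot> x = (r \<cdot> 1) x\<close>.\<close>

definition restrict_scalars ::
    "('r, 'a, _) module_scheme \<Rightarrow> ('a, 'm, _) module_scheme \<Rightarrow> ('r, 'm) module" where
  "restrict_scalars A M =
     \<lparr>carrier = carrier M, mult = mult M, one = one M, zero = zero M, add = add M,
      smult = (\<lambda>r x. (r \<odot>\<^bsub>A\<^esub> \<one>\<^bsub>A\<^esub>) \<odot>\<^bsub>M\<^esub> x)\<rparr>"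

definition self_module :: "('a, _) ring_scheme \<Rightarrow> ('a, 'a) module" where
  "self_module A =
     \<lparr>carrier = carrier A, mult = mult A, one = one A, zero = zero A, add = add A,
      smult = mult A\<rparr>"

text \<open>\<open>R\<close>-linear derivations of the \<open>R\<close>-algebra \<open>A\<close> with values in the \<open>A\<close>-module \<open>M\<close>.\<close>

definition derivation ::
    "('r, _) ring_scheme \<Rightarrow> ('r, 'a, _) module_scheme \<Rightarrow> ('a, 'm, _) module_scheme \<Rightarrow> ('a \<Rightarrow> 'm) \<Rightarrow> bool" where
  "derivation R A M \<delta> \<longleftrightarrow>
     linear_map R A (restrict_scalars A M) \<delta> \<and>
     (\<forall>f\<in>carrier A. \<forall>g\<in>carrier A. \<delta> (f \<otimes>\<^bsub>A\<^esub> g) = f \<odot>\<^bsub>M\<^esub> \<delta> g \<oplus>\<^bsub>M\<^esub> g \<odot>\<^bsub>M\<^esub> \<delta> f)"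

locale lie_algebra = module R L
  for R (structure) and L (structure) +
  fixes br :: "'b \<Rightarrow> 'b \<Rightarrow> 'b"
  assumes bilinear: "bilinear_map R L L L br"
    and alternating: "x \<in> carrier L \<Longrightarrow> br x x = \<zero>\<^bsub>L\<^esub>"
    and jacobi: "\<lbrakk>x \<in> carrier L; y \<in> carrier L; z \<in> carrier L\<rbrakk> \<Longrightarrow>
      br x (br y z) \<oplus>\<^bsub>L\<^esub> br y (br z x) \<oplus>\<^bsub>L\<^esub> br z (br x y) = \<zero>\<^bsub>L\<^esub>"

definition lie_subalgebra ::
    "'l set \<Rightarrow> ('r, _) ring_scheme \<Rightarrow> ('r, 'l, _) module_scheme \<Rightarrow> ('l \<Rightarrow> 'l \<Rightarrow> 'l) \<Rightarrow> bool" where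
  "lie_subalgebra H R L br \<longleftrightarrow> submodule H R L \<and> (\<forall>x\<in>H. \<forall>y\<in>H. br x y \<in> H)"

definition lie_hom ::
    "('r, _) ring_scheme \<Rightarrow> ('r, 'l, _) module_scheme \<Rightarrow> ('l \<Rightarrow> 'l \<Rightarrow> 'l) \<Rightarrow>
     ('r, 'k, _) module_scheme \<Rightarrow> ('k \<Rightarrow> 'k \<Rightarrow> 'k) \<Rightarrow> ('l \<Rightarrow> 'k) \<Rightarrow> bool" where
  "lie_hom R L br L' br' \<phi> \<longleftrightarrow>
     linear_map R L L' \<phi> \<and>
     (\<forall>x\<in>carrier L. \<forall>y\<in>carrier L. \<phi> (br x y) = br' (\<phi> x) (\<phi> y))"


section \<open>Poisson algebras and Hamiltonian derivations\<close>

locale poisson_algebra = algebra R A + lie_algebra R A br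
  for R (structure) and A (structure) and br +
  assumes derivation_right: "a \<in> carrier A \<Longrightarrow> derivation R A (self_module A) (br a)"
    and derivation_left: "a \<in> carrier A \<Longrightarrow> derivation R A (self_module A) (\<lambda>b. br b a)"

definition casimirs :: "('a, _) ring_scheme \<Rightarrow> ('a \<Rightarrow> 'a \<Rightarrow> 'a) \<Rightarrow> 'a set" where
  "casimirs A br = {k \<in> carrier A. \<forall>a\<in>carrier A. br k a = \<zero>\<^bsub>A\<^esub>}"

text \<open>
  Derivations are taken to be extensional (\<open>undefined\<close> off the carrier), so that equality of
  functions is equality of maps on the carrier.
\<close>

definition der_algebra ::
    "('r, _) ring_scheme \<Rightarrow> ('r, 'a, _) module_scheme \<Rightarrow> ('r, 'a \<Rightarrow> 'a) module" where
  "der_algebra R A =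
     \<lparr>carrier = {X \<in> extensional (carrier A). derivation R A (self_module A) X},
      mult = undefined, one = undefined,
      zero = (\<lambda>a\<in>carrier A. \<zero>\<^bsub>A\<^esub>),
      add = (\<lambda>X Y. \<lambda>a\<in>carrier A. X a \<oplus>\<^bsub>A\<^esub> Y a),
      smult = (\<lambda>r X. \<lambda>a\<in>carrier A. r \<odot>\<^bsub>A\<^esub> X a)\<rparr>"

definition commutator :: "('a, _) ring_scheme \<Rightarrow> ('a \<Rightarrow> 'a) \<Rightarrow> ('a \<Rightarrow> 'a) \<Rightarrow> 'a \<Rightarrow> 'a" where
  "commutator A X Y = (\<lambda>a\<in>carrier A. X (Y a) \<ominus>\<^bsub>A\<^esub> Y (X a))"

definition hamiltonian :: "('a, _) ring_scheme \<Rightarrow> ('a \<Rightarrow> 'a \<Rightarrow> 'a) \<Rightarrow> 'a \<Rightarrow> 'a \<Rightarrow> 'a" where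
  "hamiltonian A br p = restrict (br p) (carrier A)"

definition Ham :: "('a, _) ring_scheme \<Rightarrow> ('a \<Rightarrow> 'a \<Rightarrow> 'a) \<Rightarrow> ('a \<Rightarrow> 'a) set" where
  "Ham A br = hamiltonian A br ` carrier A"

definition ham_algebra ::
    "('r, _) ring_scheme \<Rightarrow> ('r, 'a, _) module_scheme \<Rightarrow> ('a \<Rightarrow> 'a \<Rightarrow> 'a) \<Rightarrow> ('r, 'a \<Rightarrow> 'a) module" where
  "ham_algebra R A br = (der_algebra R A)\<lparr>carrier := Ham A br\<rparr>"


section \<open>Kaehler differentials\<close>

text \<open>
  The module of Kaehler differentials of \<open>A\<close> over \<open>R\<close> is the free \<open>A\<close>-module on the carrier
  of \<open>A\<close> (finitely supported coefficient functions) modulo the submodule generated by the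
  relations expressing that \<open>d\<close> is an \<open>R\<close>-linear derivation.
\<close>

definition free_module :: "('a, _) ring_scheme \<Rightarrow> 'i set \<Rightarrow> ('a, 'i \<Rightarrow> 'a) module" where
  "free_module A S =
     \<lparr>carrier = {c. range c \<subseteq> carrier A \<and> {i. c i \<noteq> \<zero>\<^bsub>A\<^esub>} \<subseteq> S \<and> finite {i. c i \<noteq> \<zero>\<^bsub>A\<^esub>}},
      mult = undefined, one = undefined,
      zero = (\<lambda>i. \<zero>\<^bsub>A\<^esub>),
      add = (\<lambda>c c' i. c i \<oplus>\<^bsub>A\<^esub> c' i),
      smult = (\<lambda>a c i. a \<otimes>\<^bsub>A\<^esub> c i)\<rparr>"

definition free_gen :: "('a, _) ring_scheme \<Rightarrow> 'i \<Rightarrow> 'i \<Rightarrow> 'a" where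
  "free_gen A s = (\<lambda>i. if i = s then \<one>\<^bsub>A\<^esub> else \<zero>\<^bsub>A\<^esub>)"

definition submodule_span :: "('a, _) ring_scheme \<Rightarrow> ('a, 'm, _) module_scheme \<Rightarrow> 'm set \<Rightarrow> 'm set" where
  "submodule_span A M X = \<Inter>{N. submodule N A M \<and> X \<subseteq> N}"

definition quotient_module :: "('a, 'm, _) module_scheme \<Rightarrow> 'm set \<Rightarrow> ('a, 'm set) module" where
  "quotient_module M N =
     \<lparr>carrier = a_rcosets\<^bsub>M\<^esub> N, mult = undefined, one = undefined,
      zero = N,
      add = (\<lambda>C C'. C <+>\<^bsub>M\<^esub> C'),
      smult = (\<lambda>a C. \<Union>x\<in>C. N +>\<^bsub>M\<^esub> (a \<odot>\<^bsub>M\<^esub> x))\<rparr>"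

definition kaehler_relations ::
    "('r, _) ring_scheme \<Rightarrow> ('r, 'a, _) module_scheme \<Rightarrow> ('a \<Rightarrow> 'a) set" where
  "kaehler_relations R A =
     (let F = free_module A (carrier A); e = free_gen A in
       {e (f \<oplus>\<^bsub>A\<^esub> g) \<ominus>\<^bsub>F\<^esub> (e f \<oplus>\<^bsub>F\<^esub> e g) | f g. f \<in> carrier A \<and> g \<in> carrier A} \<union>
       {e (r \<odot>\<^bsub>A\<^esub> f) \<ominus>\<^bsub>F\<^esub> (r \<odot>\<^bsub>A\<^esub> \<one>\<^bsub>A\<^esub>) \<odot>\<^bsub>F\<^esub> e f | r f. r \<in> carrier R \<and> f \<in> carrier A} \<union>
       {e (f \<otimes>\<^bsub>A\<^esub> g) \<ominus>\<^bsub>F\<^esub> (f \<odot>\<^bsub>F\<^esub> e g \<oplus>\<^bsub>F\<^esub> g \<odot>\<^bsub>F\<^esub> e f) | f g. f \<in> carrier A \<and> g \<in> carrier A})"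

definition kaehler_submodule ::
    "('r, _) ring_scheme \<Rightarrow> ('r, 'a, _) module_scheme \<Rightarrow> ('a \<Rightarrow> 'a) set" where
  "kaehler_submodule R A =
     submodule_span A (free_module A (carrier A)) (kaehler_relations R A)"

definition kaehler ::
    "('r, _) ring_scheme \<Rightarrow> ('r, 'a, _) module_scheme \<Rightarrow> ('a, ('a \<Rightarrow> 'a) set) module" where
  "kaehler R A = quotient_module (free_module A (carrier A)) (kaehler_submodule R A)"

definition kaehler_d ::
    "('r, _) ring_scheme \<Rightarrow> ('r, 'a, _) module_scheme \<Rightarrow> 'a \<Rightarrow> ('a \<Rightarrow> 'a) set" where
  "kaehler_d R A f = kaehler_submodule R A +>\<^bsub>free_module A (carrier A)\<^esub> free_gen A f"

text \<open>
  The \<open>A\<close>-linear extension to the Kaehler module of a derivation \<open>\<delta>\<close> into \<open>M\<close>; it sends the class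
  of a formal combination of generators \<open>h\<close> with coefficients \<open>c h\<close> to the sum of the
  \<open>c h \<cdot> \<delta> h\<close>. Its universal property is proved below.
\<close>

definition formal_eval :: "('a, _) ring_scheme \<Rightarrow> ('a, 'm, _) module_scheme \<Rightarrow> ('a \<Rightarrow> 'm) \<Rightarrow> ('a \<Rightarrow> 'a) \<Rightarrow> 'm" where
  "formal_eval A M \<delta> c = (\<Oplus>\<^bsub>M\<^esub>h\<in>{h. c h \<noteq> \<zero>\<^bsub>A\<^esub>}. c h \<odot>\<^bsub>M\<^esub> \<delta> h)"

definition kaehler_lift ::
    "('a, _) ring_scheme \<Rightarrow> ('a, 'm, _) module_scheme \<Rightarrow> ('a \<Rightarrow> 'm) \<Rightarrow> ('a \<Rightarrow> 'a) set \<Rightarrow> 'm" where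
  "kaehler_lift A M \<delta> \<alpha> = (THE y. \<forall>c\<in>\<alpha>. y = formal_eval A M \<delta> c)"

text \<open>\<open>anchor A br \<alpha>\<close> is the derivation of \<open>A\<close> with \<open>anchor A br (dh) = br h\<close>.\<close>

definition anchor :: "('a, _) ring_scheme \<Rightarrow> ('a \<Rightarrow> 'a \<Rightarrow> 'a) \<Rightarrow> ('a \<Rightarrow> 'a) set \<Rightarrow> 'a \<Rightarrow> 'a" where
  "anchor A br \<alpha> f = kaehler_lift A (self_module A) (\<lambda>h. br h f) \<alpha>"

lemma free_module_module:
  assumes "cring A"
  shows "module A (free_module A S)"
proof -
  interpret A: cring A by fact
  let ?F = "free_module A S"
  have fin: "finite {i. c i \<oplus>\<^bsub>A\<^esub> c' i \<noteq> \<zero>\<^bsub>A\<^esub>} \<and> {i. c i \<oplus>\<^bsub>A\<^esub> c' i \<noteq> \<zero>\<^bsub>A\<^esub>} \<subseteq> S"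
    if "c \<in> carrier ?F" "c' \<in> carrier ?F" for c c'
  proof -
    have "{i. c i \<oplus>\<^bsub>A\<^esub> c' i \<noteq> \<zero>\<^bsub>A\<^esub>} \<subseteq> {i. c i \<noteq> \<zero>\<^bsub>A\<^esub>} \<union> {i. c' i \<noteq> \<zero>\<^bsub>A\<^esub>}" by auto
    with that show ?thesis
      by (auto simp: free_module_def intro: finite_subset)
  qed
  have fin': "finite {i. a \<otimes>\<^bsub>A\<^esub> c i \<noteq> \<zero>\<^bsub>A\<^esub>} \<and> {i. a \<otimes>\<^bsub>A\<^esub> c i \<noteq> \<zero>\<^bsub>A\<^esub>} \<subseteq> S"
    if "c \<in> carrier ?F" "a \<in> carrier A" for c a
  proof -
    have "{i. a \<otimes>\<^bsub>A\<^esub> c i \<noteq> \<zero>\<^bsub>A\<^esub>} \<subseteq> {i. c i \<noteq> \<zero>\<^bsub>A\<^esub>}" using that by auto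
    with that show ?thesis
      by (auto simp: free_module_def intro: finite_subset)
  qed
  have car: "c i \<in> carrier A" if "c \<in> carrier ?F" for c i
    using that by (auto simp: free_module_def)
  have smc: "a \<odot>\<^bsub>?F\<^esub> c \<in> carrier ?F" if "c \<in> carrier ?F" "a \<in> carrier A" for c a
    using fin'[OF that] car[OF that(1)] that(2) by (auto simp: free_module_def)
  have "abelian_group ?F"
  proof (rule abelian_groupI)
    fix x y assume xy: "x \<in> carrier ?F" "y \<in> carrier ?F"
    show "x \<oplus>\<^bsub>?F\<^esub> y \<in> carrier ?F"
      using fin[OF xy] car[OF xy(1)] car[OF xy(2)] by (auto simp: free_module_def)
    show "x \<oplus>\<^bsub>?F\<^esub> y = y \<oplus>\<^bsub>?F\<^esub> x"
      using car[OF xy(1)] car[OF xy(2)] by (simp add: free_module_def A.a_comm)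
  next
    fix x y z assume xyz: "x \<in> carrier ?F" "y \<in> carrier ?F" "z \<in> carrier ?F"
    show "(x \<oplus>\<^bsub>?F\<^esub> y) \<oplus>\<^bsub>?F\<^esub> z = x \<oplus>\<^bsub>?F\<^esub> (y \<oplus>\<^bsub>?F\<^esub> z)"
      using car[OF xyz(1)] car[OF xyz(2)] car[OF xyz(3)] by (simp add: free_module_def A.a_assoc)
  next
    fix x assume x: "x \<in> carrier ?F"
    show "\<zero>\<^bsub>?F\<^esub> \<oplus>\<^bsub>?F\<^esub> x = x"
      using car[OF x] by (simp add: free_module_def)
    show "\<exists>y\<in>carrier ?F. y \<oplus>\<^bsub>?F\<^esub> x = \<zero>\<^bsub>?F\<^esub>"
    proof
      show "(\<ominus>\<^bsub>A\<^esub> \<one>\<^bsub>A\<^esub>) \<odot>\<^bsub>?F\<^esub> x \<in> carrier ?F" using smc[OF x] by simp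
      show "(\<ominus>\<^bsub>A\<^esub> \<one>\<^bsub>A\<^esub>) \<odot>\<^bsub>?F\<^esub> x \<oplus>\<^bsub>?F\<^esub> x = \<zero>\<^bsub>?F\<^esub>"
        using car[OF x] by (simp add: free_module_def A.l_minus A.l_neg)
    qed
  qed (auto simp: free_module_def)
  then show ?thesis
  proof (rule moduleI[OF assms])
    show "a \<odot>\<^bsub>?F\<^esub> x \<in> carrier ?F" if "a \<in> carrier A" "x \<in> carrier ?F" for a x
      using smc that by blast
    show "(a \<oplus>\<^bsub>A\<^esub> b) \<odot>\<^bsub>?F\<^esub> x = a \<odot>\<^bsub>?F\<^esub> x \<oplus>\<^bsub>?F\<^esub> b \<odot>\<^bsub>?F\<^esub> x"
      if "a \<in> carrier A" "b \<in> carrier A" "x \<in> carrier ?F" for a b x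
      using that car[OF that(3)] by (simp add: free_module_def A.l_distr)
    show "a \<odot>\<^bsub>?F\<^esub> (x \<oplus>\<^bsub>?F\<^esub> y) = a \<odot>\<^bsub>?F\<^esub> x \<oplus>\<^bsub>?F\<^esub> a \<odot>\<^bsub>?F\<^esub> y"
      if "a \<in> carrier A" "x \<in> carrier ?F" "y \<in> carrier ?F" for a x y
      using that car[OF that(2)] car[OF that(3)] by (simp add: free_module_def A.r_distr)
    show "(a \<otimes>\<^bsub>A\<^esub> b) \<odot>\<^bsub>?F\<^esub> x = a \<odot>\<^bsub>?F\<^esub> (b \<odot>\<^bsub>?F\<^esub> x)"
      if "a \<in> carrier A" "b \<in> carrier A" "x \<in> carrier ?F" for a b x
      using that car[OF that(3)] by (simp add: free_module_def A.m_assoc)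
    show "\<one>\<^bsub>A\<^esub> \<odot>\<^bsub>?F\<^esub> x = x" if "x \<in> carrier ?F" for x
      using car[OF that] by (simp add: free_module_def)
  qed
qed

lemma free_gen_closed:
  assumes "cring A" "s \<in> S"
  shows "free_gen A s \<in> carrier (free_module A S)"
proof -
  interpret A: cring A by fact
  have "{i. free_gen A s i \<noteq> \<zero>\<^bsub>A\<^esub>} \<subseteq> {s}" by (auto simp: free_gen_def)
  with assms(2) show ?thesis
    by (auto simp: free_module_def free_gen_def intro: finite_subset)
qed

context module
begin

lemma submodule_abelian_subgroup:
  assumes "submodule N R M"
  shows "abelian_subgroup N M"
proof -
  interpret N: submodule N R M by fact
  show ?thesis
    by (rule abelian_subgroupI3[OF _ M.abelian_group_axioms])
      (simp add: additive_subgroup_def N.subgroup_axioms)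
qed

lemma submodule_span_submodule:
  assumes "X \<subseteq> carrier M"
  shows "submodule (submodule_span R M X) R M" and "X \<subseteq> submodule_span R M X"
proof -
  let ?S = "{N. submodule N R M \<and> X \<subseteq> N}"
  have C: "carrier M \<in> ?S" using carrier_is_submodule assms by auto
  have E: "\<And>N. N \<in> ?S \<Longrightarrow> submodule N R M" by blast
  show "submodule (submodule_span R M X) R M"
  proof (rule submoduleI)
    show "submodule_span R M X \<subseteq> carrier M" using C by (auto simp: submodule_span_def)
    show "\<zero>\<^bsub>M\<^esub> \<in> submodule_span R M X"
      using submodule.axioms(1) subgroup.one_closed by (force simp: submodule_span_def)
  next
    fix a assume "a \<in> submodule_span R M X"
    then show "\<ominus>\<^bsub>M\<^esub> a \<in> submodule_span R M X"
      using submoduleE(3) by (auto simp: submodule_span_def)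
  next
    fix a b assume "a \<in> submodule_span R M X" "b \<in> submodule_span R M X"
    then show "a \<oplus>\<^bsub>M\<^esub> b \<in> submodule_span R M X"
      using submoduleE(5) by (auto simp: submodule_span_def)
  next
    fix a b assume "a \<in> carrier R" "b \<in> submodule_span R M X"
    then show "a \<odot>\<^bsub>M\<^esub> b \<in> submodule_span R M X"
      using submoduleE(4) by (auto simp: submodule_span_def)
  qed
  show "X \<subseteq> submodule_span R M X" by (auto simp: submodule_span_def)
qed

context
  fixes N assumes N: "submodule N R M"
begin

interpretation N: abelian_subgroup N M by (rule submodule_abelian_subgroup[OF N])

lemma quotient_smult:
  assumes "a \<in> carrier R" "x \<in> carrier M"
  shows "a \<odot>\<^bsub>quotient_module M N\<^esub> (N +>\<^bsub>M\<^esub> x) = N +>\<^bsub>M\<^esub> (a \<odot>\<^bsub>M\<^esub> x)"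
proof -
  have "N +>\<^bsub>M\<^esub> (a \<odot>\<^bsub>M\<^esub> y) = N +>\<^bsub>M\<^esub> (a \<odot>\<^bsub>M\<^esub> x)" if y: "y \<in> N +>\<^bsub>M\<^esub> x" for y
  proof -
    obtain n where n: "n \<in> N" "y = n \<oplus>\<^bsub>M\<^esub> x"
      using y by (auto simp: a_r_coset_def r_coset_def)
    have nM: "n \<in> carrier M" using n N.a_Hcarr by blast
    have "a \<odot>\<^bsub>M\<^esub> y = a \<odot>\<^bsub>M\<^esub> n \<oplus>\<^bsub>M\<^esub> a \<odot>\<^bsub>M\<^esub> x"
      using n nM assms by (simp add: smult_r_distr)
    moreover have "a \<odot>\<^bsub>M\<^esub> n \<in> N" using submoduleE(4)[OF N] n assms by blast
    ultimately have "a \<odot>\<^bsub>M\<^esub> y \<in> N +>\<^bsub>M\<^esub> (a \<odot>\<^bsub>M\<^esub> x)"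
      by (auto simp: a_r_coset_def r_coset_def)
    then show ?thesis
      using N.a_repr_independence'[OF _ smult_closed[OF assms]] by simp
  qed
  moreover have "x \<in> N +>\<^bsub>M\<^esub> x" using N.a_rcos_self assms by blast
  ultimately have "(\<Union>y\<in>N +>\<^bsub>M\<^esub> x. N +>\<^bsub>M\<^esub> (a \<odot>\<^bsub>M\<^esub> y)) = N +>\<^bsub>M\<^esub> (a \<odot>\<^bsub>M\<^esub> x)"
    by (intro SUP_eq_const) blast+
  then show ?thesis by (simp add: quotient_module_def)
qed

lemma quotient_add:
  assumes "x \<in> carrier M" "y \<in> carrier M"
  shows "(N +>\<^bsub>M\<^esub> x) \<oplus>\<^bsub>quotient_module M N\<^esub> (N +>\<^bsub>M\<^esub> y) = N +>\<^bsub>M\<^esub> (x \<oplus>\<^bsub>M\<^esub> y)"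
  using N.a_rcos_sum assms by (simp add: quotient_module_def)

lemma quotient_carrier:
  "C \<in> carrier (quotient_module M N) \<longleftrightarrow> (\<exists>x\<in>carrier M. C = N +>\<^bsub>M\<^esub> x)"
  by (simp add: quotient_module_def A_RCOSETS_def')

lemma quotient_zero: "\<zero>\<^bsub>quotient_module M N\<^esub> = N +>\<^bsub>M\<^esub> \<zero>\<^bsub>M\<^esub>"
  using N.a_subset M.a_coset_add_zero by (simp add: quotient_module_def)

lemma quotient_module_module: "module R (quotient_module M N)"
proof -
  let ?Q = "quotient_module M N"
  note q = quotient_smult quotient_add
  have cl: "N +>\<^bsub>M\<^esub> x \<in> carrier ?Q" if "x \<in> carrier M" for x
    using that quotient_carrier by blast
  have ob: "\<exists>x\<in>carrier M. C = N +>\<^bsub>M\<^esub> x" if "C \<in> carrier ?Q" for C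
    using that quotient_carrier by blast
  have "abelian_group ?Q"
  proof (rule abelian_groupI)
    show "\<zero>\<^bsub>?Q\<^esub> \<in> carrier ?Q" unfolding quotient_zero by (rule cl) simp
  next
    fix C assume "C \<in> carrier ?Q"
    from ob[OF this] obtain x where x: "x \<in> carrier M" and C: "C = N +>\<^bsub>M\<^esub> x" by blast
    show "\<zero>\<^bsub>?Q\<^esub> \<oplus>\<^bsub>?Q\<^esub> C = C" using x by (simp add: C quotient_zero q)
    show "\<exists>B\<in>carrier ?Q. B \<oplus>\<^bsub>?Q\<^esub> C = \<zero>\<^bsub>?Q\<^esub>"
    proof
      show "N +>\<^bsub>M\<^esub> (\<ominus>\<^bsub>M\<^esub> x) \<in> carrier ?Q" using x by (intro cl) simp
      show "(N +>\<^bsub>M\<^esub> (\<ominus>\<^bsub>M\<^esub> x)) \<oplus>\<^bsub>?Q\<^esub> C = \<zero>\<^bsub>?Q\<^esub>"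
        using x by (simp add: C quotient_zero q M.l_neg)
    qed
  next
    fix B C assume "B \<in> carrier ?Q" "C \<in> carrier ?Q"
    with ob obtain x y where x: "x \<in> carrier M" "y \<in> carrier M"
      and BC: "B = N +>\<^bsub>M\<^esub> x" "C = N +>\<^bsub>M\<^esub> y" by blast
    show "B \<oplus>\<^bsub>?Q\<^esub> C \<in> carrier ?Q"
      unfolding BC quotient_add[OF x] using x by (intro cl) simp
    show "B \<oplus>\<^bsub>?Q\<^esub> C = C \<oplus>\<^bsub>?Q\<^esub> B"
      unfolding BC quotient_add[OF x] quotient_add[OF x(2,1)] M.a_comm[OF x] ..
  next
    fix B C D assume "B \<in> carrier ?Q" "C \<in> carrier ?Q" "D \<in> carrier ?Q"
    with ob obtain x y z where x: "x \<in> carrier M" "y \<in> carrier M" "z \<in> carrier M"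
      and BCD: "B = N +>\<^bsub>M\<^esub> x" "C = N +>\<^bsub>M\<^esub> y" "D = N +>\<^bsub>M\<^esub> z"
      by (metis (no_types))
    show "(B \<oplus>\<^bsub>?Q\<^esub> C) \<oplus>\<^bsub>?Q\<^esub> D = B \<oplus>\<^bsub>?Q\<^esub> (C \<oplus>\<^bsub>?Q\<^esub> D)"
      using x by (simp add: BCD q M.a_assoc)
  qed
  then show ?thesis
  proof (rule moduleI[OF R.cring_axioms])
    fix a C assume a: "a \<in> carrier R" and "C \<in> carrier ?Q"
    from ob[OF this(2)] obtain x where x: "x \<in> carrier M" and C: "C = N +>\<^bsub>M\<^esub> x" by blast
    show "a \<odot>\<^bsub>?Q\<^esub> C \<in> carrier ?Q"
      unfolding C quotient_smult[OF a x] using a x by (intro cl) simp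
    show "(a \<oplus>\<^bsub>R\<^esub> b) \<odot>\<^bsub>?Q\<^esub> C = a \<odot>\<^bsub>?Q\<^esub> C \<oplus>\<^bsub>?Q\<^esub> b \<odot>\<^bsub>?Q\<^esub> C"
      if "b \<in> carrier R" for b
      using that a x by (simp add: C q smult_l_distr)
    show "(a \<otimes>\<^bsub>R\<^esub> b) \<odot>\<^bsub>?Q\<^esub> C = a \<odot>\<^bsub>?Q\<^esub> (b \<odot>\<^bsub>?Q\<^esub> C)"
      if "b \<in> carrier R" for b
      using that a x by (simp add: C q smult_assoc1)
    fix D assume "D \<in> carrier ?Q"
    from ob[OF this] obtain y where y: "y \<in> carrier M" and D: "D = N +>\<^bsub>M\<^esub> y" by blast
    show "a \<odot>\<^bsub>?Q\<^esub> (C \<oplus>\<^bsub>?Q\<^esub> D) = a \<odot>\<^bsub>?Q\<^esub> C \<oplus>\<^bsub>?Q\<^esub> a \<odot>\<^bsub>?Q\<^esub> D"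
      using a x y by (simp add: C D q smult_r_distr)
  next
    fix C assume "C \<in> carrier ?Q"
    from ob[OF this] obtain x where x: "x \<in> carrier M" and C: "C = N +>\<^bsub>M\<^esub> x" by blast
    show "\<one>\<^bsub>R\<^esub> \<odot>\<^bsub>?Q\<^esub> C = C" using x by (simp add: C q)
  qed
qed

end

end

context algebra
begin

abbreviation (input) "kF \<equiv> free_module M (carrier M)"
abbreviation (input) "kN \<equiv> kaehler_submodule R M"

lemma kF_module: "module M kF"
  by (rule free_module_module[OF M_cring])

lemma kaehler_relations_closed: "kaehler_relations R M \<subseteq> carrier kF"
proof -
  interpret F: module M kF by (rule kF_module)
  note [simp] = free_gen_closed[OF M_cring]
  show ?thesis unfolding kaehler_relations_def Let_def by auto
qed

lemma kN_submodule: "submodule kN M kF"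
  and kN_relations: "kaehler_relations R M \<subseteq> kN"
  unfolding kaehler_submodule_def
  using module.submodule_span_submodule[OF kF_module kaehler_relations_closed] by auto

lemma kaehler_module: "module M (kaehler R M)"
  unfolding kaehler_def by (rule module.quotient_module_module[OF kF_module kN_submodule])

lemma kN_cong:
  assumes "x \<ominus>\<^bsub>kF\<^esub> y \<in> kN" "x \<in> carrier kF" "y \<in> carrier kF"
  shows "kN +>\<^bsub>kF\<^esub> x = kN +>\<^bsub>kF\<^esub> y"
proof -
  interpret F: module M kF by (rule kF_module)
  interpret N: abelian_subgroup kN kF by (rule F.submodule_abelian_subgroup[OF kN_submodule])
  have "x \<in> kN +>\<^bsub>kF\<^esub> y" using N.a_rcos_module[OF assms(3,2)] assms(1) by (simp add: F.M.minus_eq)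
  from N.a_repr_independence'[OF this assms(3)] show ?thesis by simp
qed

lemma kaehler_d_derivation: "derivation R M (kaehler R M) (kaehler_d R M)"
proof -
  interpret F: module M kF by (rule kF_module)
  note e = free_gen_closed[OF M_cring]
  note q = F.quotient_smult[OF kN_submodule] F.quotient_add[OF kN_submodule]
  have 1: "kaehler_d R M (f \<oplus>\<^bsub>M\<^esub> g) = kN +>\<^bsub>kF\<^esub> (free_gen M f \<oplus>\<^bsub>kF\<^esub> free_gen M g)"
    if "f \<in> carrier M" "g \<in> carrier M" for f g
    unfolding kaehler_d_def
  proof (rule kN_cong)
    show "free_gen M (f \<oplus>\<^bsub>M\<^esub> g) \<ominus>\<^bsub>kF\<^esub> (free_gen M f \<oplus>\<^bsub>kF\<^esub> free_gen M g) \<in> kN"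
      by (rule subsetD[OF kN_relations], unfold kaehler_relations_def Let_def, rule UnI1, rule UnI1,
        rule CollectI, rule exI[of _ f], rule exI[of _ g], intro conjI refl that)
  qed (intro F.M.a_closed F.smult_closed e M.a_closed smult_closed m_closed one_closed that)+
  have 2: "kaehler_d R M (r \<odot>\<^bsub>M\<^esub> f) = kN +>\<^bsub>kF\<^esub> ((r \<odot>\<^bsub>M\<^esub> \<one>\<^bsub>M\<^esub>) \<odot>\<^bsub>kF\<^esub> free_gen M f)"
    if "r \<in> carrier R" "f \<in> carrier M" for r f
    unfolding kaehler_d_def
  proof (rule kN_cong)
    show "free_gen M (r \<odot>\<^bsub>M\<^esub> f) \<ominus>\<^bsub>kF\<^esub> (r \<odot>\<^bsub>M\<^esub> \<one>\<^bsub>M\<^esub>) \<odot>\<^bsub>kF\<^esub> free_gen M f \<in> kN"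
      by (rule subsetD[OF kN_relations], unfold kaehler_relations_def Let_def, rule UnI1, rule UnI2,
        rule CollectI, rule exI[of _ r], rule exI[of _ f], intro conjI refl that)
  qed (intro F.M.a_closed F.smult_closed e M.a_closed smult_closed m_closed one_closed that)+
  have 3: "kaehler_d R M (f \<otimes>\<^bsub>M\<^esub> g) =
      kN +>\<^bsub>kF\<^esub> (f \<odot>\<^bsub>kF\<^esub> free_gen M g \<oplus>\<^bsub>kF\<^esub> g \<odot>\<^bsub>kF\<^esub> free_gen M f)"
    if "f \<in> carrier M" "g \<in> carrier M" for f g
    unfolding kaehler_d_def
  proof (rule kN_cong)
    show "free_gen M (f \<otimes>\<^bsub>M\<^esub> g) \<ominus>\<^bsub>kF\<^esub> (f \<odot>\<^bsub>kF\<^esub> free_gen M g \<oplus>\<^bsub>kF\<^esub> g \<odot>\<^bsub>kF\<^esub> free_gen M f) \<in> kN"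
      by (rule subsetD[OF kN_relations], unfold kaehler_relations_def Let_def, rule UnI2,
        rule CollectI, rule exI[of _ f], rule exI[of _ g], intro conjI refl that)
  qed (intro F.M.a_closed F.smult_closed e M.a_closed smult_closed m_closed one_closed that)+
  have 0: "kaehler_d R M f \<in> carrier (kaehler R M)" if "f \<in> carrier M" for f
    unfolding kaehler_def F.quotient_carrier[OF kN_submodule] kaehler_d_def
    using e[OF that] by blast
  have s: "carrier (restrict_scalars M (kaehler R M)) = carrier (kaehler R M)"
    "add (restrict_scalars M (kaehler R M)) = add (kaehler R M)"
    "smult (restrict_scalars M (kaehler R M)) =
      (\<lambda>r x. (r \<odot>\<^bsub>M\<^esub> \<one>\<^bsub>M\<^esub>) \<odot>\<^bsub>kaehler R M\<^esub> x)"
    by (simp_all add: restrict_scalars_def)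
  show ?thesis
    unfolding derivation_def linear_map_def s
  proof (intro conjI ballI Pi_I)
    show "kaehler_d R M (f \<oplus>\<^bsub>M\<^esub> g) = kaehler_d R M f \<oplus>\<^bsub>kaehler R M\<^esub> kaehler_d R M g"
      if "f \<in> carrier M" "g \<in> carrier M" for f g
      unfolding 1[OF that] unfolding kaehler_def kaehler_d_def using that by (simp only: q e)
    show "kaehler_d R M (r \<odot>\<^bsub>M\<^esub> f) = (r \<odot>\<^bsub>M\<^esub> \<one>\<^bsub>M\<^esub>) \<odot>\<^bsub>kaehler R M\<^esub> kaehler_d R M f"
      if "r \<in> carrier R" "f \<in> carrier M" for r f
      unfolding 2[OF that] unfolding kaehler_def kaehler_d_def
      using that smult_closed[OF that(1) one_closed] by (simp only: q e)
    show "kaehler_d R M (f \<otimes>\<^bsub>M\<^esub> g) = f \<odot>\<^bsub>kaehler R M\<^esub> kaehler_d R M g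
        \<oplus>\<^bsub>kaehler R M\<^esub> g \<odot>\<^bsub>kaehler R M\<^esub> kaehler_d R M f"
      if "f \<in> carrier M" "g \<in> carrier M" for f g
      unfolding 3[OF that] unfolding kaehler_def kaehler_d_def
      using that by (simp only: q e F.smult_closed)
  qed (rule 0)
qed

end

lemma formal_eval_superset:
  assumes "module A Q" "\<delta> \<in> S \<rightarrow> carrier Q" "c \<in> carrier (free_module A S)"
    "finite T" "{i. c i \<noteq> \<zero>\<^bsub>A\<^esub>} \<subseteq> T" "T \<subseteq> S"
  shows "formal_eval A Q \<delta> c = (\<Oplus>\<^bsub>Q\<^esub>h\<in>T. c h \<odot>\<^bsub>Q\<^esub> \<delta> h)"
proof -
  interpret Q: module A Q by fact
  have c: "c i \<in> carrier A" for i using assms(3) by (auto simp: free_module_def)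
  show ?thesis
    unfolding formal_eval_def
  proof (rule Q.M.add.finprod_mono_neutral_cong_left[OF assms(4,5)])
    show "c h \<odot>\<^bsub>Q\<^esub> \<delta> h = \<zero>\<^bsub>Q\<^esub>" if "h \<in> T - {i. c i \<noteq> \<zero>\<^bsub>A\<^esub>}" for h
    proof -
      have h: "h \<in> S" using that assms(6) by blast
      have "\<delta> h \<in> carrier Q" by (rule funcset_mem[OF assms(2) h])
      moreover have "c h = \<zero>\<^bsub>A\<^esub>" using that by simp
      ultimately show ?thesis by simp
    qed
  next
    show "(\<lambda>h. c h \<odot>\<^bsub>Q\<^esub> \<delta> h) \<in> T \<rightarrow> carrier Q"
      using funcset_mem[OF assms(2)] assms(6) c by (intro Pi_I Q.smult_closed) auto
  qed simp
qed

lemma formal_eval_linear: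
  assumes "module A Q" "\<delta> \<in> S \<rightarrow> carrier Q"
  shows "linear_map A (free_module A S) Q (formal_eval A Q \<delta>)"
proof -
  interpret Q: module A Q by fact
  interpret F: module A "free_module A S" by (rule free_module_module[OF Q.R.cring_axioms])
  have car: "c i \<in> carrier A" if "c \<in> carrier (free_module A S)" for c i
    using that by (auto simp: free_module_def)
  have sup: "finite {i. c i \<noteq> \<zero>\<^bsub>A\<^esub>}" "{i. c i \<noteq> \<zero>\<^bsub>A\<^esub>} \<subseteq> S" if "c \<in> carrier (free_module A S)" for c
    using that by (auto simp: free_module_def)
  show ?thesis
    unfolding linear_map_def
  proof (intro conjI ballI Pi_I)
    fix c assume c: "c \<in> carrier (free_module A S)"
    show "formal_eval A Q \<delta> c \<in> carrier Q"
      unfolding formal_eval_def using car[OF c] sup[OF c] assms(2)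
      by (intro Q.M.finsum_closed) auto
  next
    fix c c' assume c: "c \<in> carrier (free_module A S)" "c' \<in> carrier (free_module A S)"
    let ?T = "{i. c i \<noteq> \<zero>\<^bsub>A\<^esub>} \<union> {i. c' i \<noteq> \<zero>\<^bsub>A\<^esub>}"
    have T: "finite ?T" "?T \<subseteq> S" using sup[OF c(1)] sup[OF c(2)] by auto
    have "formal_eval A Q \<delta> (c \<oplus>\<^bsub>free_module A S\<^esub> c')
        = (\<Oplus>\<^bsub>Q\<^esub>h\<in>?T. (c \<oplus>\<^bsub>free_module A S\<^esub> c') h \<odot>\<^bsub>Q\<^esub> \<delta> h)"
    proof (rule formal_eval_superset[OF assms _ T(1) _ T(2)])
      show "c \<oplus>\<^bsub>free_module A S\<^esub> c' \<in> carrier (free_module A S)" using c by simp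
    qed (auto simp: free_module_def)
    also have "\<dots> = (\<Oplus>\<^bsub>Q\<^esub>h\<in>?T. c h \<odot>\<^bsub>Q\<^esub> \<delta> h \<oplus>\<^bsub>Q\<^esub> c' h \<odot>\<^bsub>Q\<^esub> \<delta> h)"
      using T assms(2) car[OF c(1)] car[OF c(2)]
      by (intro Q.M.finsum_cong') (auto simp: free_module_def Q.smult_l_distr Pi_iff subset_iff)
    also have "\<dots> = (\<Oplus>\<^bsub>Q\<^esub>h\<in>?T. c h \<odot>\<^bsub>Q\<^esub> \<delta> h) \<oplus>\<^bsub>Q\<^esub> (\<Oplus>\<^bsub>Q\<^esub>h\<in>?T. c' h \<odot>\<^bsub>Q\<^esub> \<delta> h)"
      using T assms(2) car[OF c(1)] car[OF c(2)]
      by (intro Q.M.finsum_addf) (auto simp: Pi_iff subset_iff)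
    also have "\<dots> = formal_eval A Q \<delta> c \<oplus>\<^bsub>Q\<^esub> formal_eval A Q \<delta> c'"
      using formal_eval_superset[OF assms c(1) T(1) _ T(2)]
        formal_eval_superset[OF assms c(2) T(1) _ T(2)] by simp
    finally show "formal_eval A Q \<delta> (c \<oplus>\<^bsub>free_module A S\<^esub> c')
        = formal_eval A Q \<delta> c \<oplus>\<^bsub>Q\<^esub> formal_eval A Q \<delta> c'" .
  next
    fix a c assume a: "a \<in> carrier A" and c: "c \<in> carrier (free_module A S)"
    let ?T = "{i. c i \<noteq> \<zero>\<^bsub>A\<^esub>}"
    have "formal_eval A Q \<delta> (a \<odot>\<^bsub>free_module A S\<^esub> c)
        = (\<Oplus>\<^bsub>Q\<^esub>h\<in>?T. (a \<odot>\<^bsub>free_module A S\<^esub> c) h \<odot>\<^bsub>Q\<^esub> \<delta> h)"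
    proof (rule formal_eval_superset[OF assms _ sup(1)[OF c] _ sup(2)[OF c]])
      show "a \<odot>\<^bsub>free_module A S\<^esub> c \<in> carrier (free_module A S)" using a c by simp
    qed (use a in \<open>auto simp: free_module_def\<close>)
    also have "\<dots> = (\<Oplus>\<^bsub>Q\<^esub>h\<in>?T. a \<odot>\<^bsub>Q\<^esub> (c h \<odot>\<^bsub>Q\<^esub> \<delta> h))"
      using sup[OF c] a assms(2) car[OF c]
      by (intro Q.M.finsum_cong') (auto simp: free_module_def Q.smult_assoc1 Pi_iff subset_iff)
    also have "\<dots> = a \<odot>\<^bsub>Q\<^esub> formal_eval A Q \<delta> c"
      unfolding formal_eval_def using sup[OF c] a assms(2) car[OF c]
      by (intro Q.finsum_smult_ldistr[symmetric]) auto
    finally show "formal_eval A Q \<delta> (a \<odot>\<^bsub>free_module A S\<^esub> c) = a \<odot>\<^bsub>Q\<^esub> formal_eval A Q \<delta> c" .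
  qed
qed

lemma formal_eval_gen:
  assumes "module A Q" "\<delta> \<in> S \<rightarrow> carrier Q" "s \<in> S"
  shows "formal_eval A Q \<delta> (free_gen A s) = \<delta> s"
proof -
  interpret Q: module A Q by fact
  have "formal_eval A Q \<delta> (free_gen A s) = (\<Oplus>\<^bsub>Q\<^esub>h\<in>{s}. free_gen A s h \<odot>\<^bsub>Q\<^esub> \<delta> h)"
    by (rule formal_eval_superset[OF assms(1,2) free_gen_closed[OF Q.R.cring_axioms assms(3)]])
      (use assms(3) in \<open>auto simp: free_gen_def split: if_splits\<close>)
  also have "\<dots> = \<delta> s"
  proof -
    have "\<delta> s \<in> carrier Q" by (rule funcset_mem[OF assms(2,3)])
    then show ?thesis by (subst Q.M.finsum_insert) (auto simp: free_gen_def)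
  qed
  finally show ?thesis .
qed

lemma linear_map_minus:
  assumes "module A M" "module A Q" "linear_map A M Q \<phi>" "x \<in> carrier M" "y \<in> carrier M"
  shows "\<phi> (x \<ominus>\<^bsub>M\<^esub> y) = \<phi> x \<ominus>\<^bsub>Q\<^esub> \<phi> y"
proof -
  interpret M: module A M by fact
  interpret Q: module A Q by fact
  have c: "\<phi> z \<in> carrier Q" if "z \<in> carrier M" for z using assms(3) that by (auto simp: linear_map_def)
  have "\<phi> ((x \<ominus>\<^bsub>M\<^esub> y) \<oplus>\<^bsub>M\<^esub> y) = \<phi> (x \<ominus>\<^bsub>M\<^esub> y) \<oplus>\<^bsub>Q\<^esub> \<phi> y"
    using assms(3-5) by (simp add: linear_map_def)
  moreover have "(x \<ominus>\<^bsub>M\<^esub> y) \<oplus>\<^bsub>M\<^esub> y = x"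
    using assms(4,5) by (simp add: M.M.minus_eq M.M.a_assoc M.M.l_neg)
  ultimately have e: "\<phi> x = \<phi> (x \<ominus>\<^bsub>M\<^esub> y) \<oplus>\<^bsub>Q\<^esub> \<phi> y" by simp
  show ?thesis unfolding e using assms(4,5) c
    by (simp add: Q.M.minus_eq Q.M.a_assoc Q.M.r_neg)
qed

lemma linear_map_eq_gen:
  assumes "module A Q" and \<phi>: "linear_map A (free_module A S) Q \<phi>"
    and c: "c \<in> carrier (free_module A S)"
  shows "\<phi> c = formal_eval A Q (\<lambda>s. \<phi> (free_gen A s)) c"
proof -
  interpret Q: module A Q by fact
  let ?F = "free_module A S" and ?\<delta> = "\<lambda>s. \<phi> (free_gen A s)"
  interpret F: module A ?F by (rule free_module_module[OF Q.R.cring_axioms])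
  note g = free_gen_closed[OF Q.R.cring_axioms]
  have \<delta>: "?\<delta> \<in> S \<rightarrow> carrier Q" 
  proof
    fix s assume "s \<in> S"
    then show "?\<delta> s \<in> carrier Q" using \<phi> g[of s S] unfolding linear_map_def by blast
  qed
  note lin = formal_eval_linear[OF assms(1) \<delta>]
  have "\<phi> c = formal_eval A Q ?\<delta> c"
    if "finite T" "T \<subseteq> S" "{i. c i \<noteq> \<zero>\<^bsub>A\<^esub>} \<subseteq> T" "c \<in> carrier ?F" for T c
    using that
  proof (induction T arbitrary: c rule: finite_induct)
    case empty
    have cz: "c i = \<zero>\<^bsub>A\<^esub>" for i using empty.prems(2) by blast
    have c0: "c = \<zero>\<^bsub>A\<^esub> \<odot>\<^bsub>?F\<^esub> c" by (simp add: free_module_def cz fun_eq_iff)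
    have z: "\<psi> c = \<zero>\<^bsub>Q\<^esub>" if \<psi>: "linear_map A ?F Q \<psi>" for \<psi>
    proof -
      have "\<psi> c \<in> carrier Q" "\<psi> (\<zero>\<^bsub>A\<^esub> \<odot>\<^bsub>?F\<^esub> c) = \<zero>\<^bsub>A\<^esub> \<odot>\<^bsub>Q\<^esub> \<psi> c"
        using \<psi> empty.prems(3) Q.R.zero_closed unfolding linear_map_def by blast+
      then show ?thesis unfolding c0[symmetric] by simp
    qed
    show ?case by (simp add: z[OF \<phi>] z[OF lin])
  next
    case (insert s T)
    let ?c' = "c(s := \<zero>\<^bsub>A\<^esub>)"
    have s: "s \<in> S" and TS: "T \<subseteq> S" using insert.prems(1) by auto
    have cF: "c i \<in> carrier A" for i
      using insert.prems(3) unfolding free_module_def by auto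
    have c'T: "{i. ?c' i \<noteq> \<zero>\<^bsub>A\<^esub>} \<subseteq> T" using insert.prems(2) by auto
    have c': "?c' \<in> carrier ?F"
      using finite_subset[OF c'T insert.hyps(1)] order_trans[OF c'T TS] cF Q.R.zero_closed
      unfolding free_module_def by (simp add: image_subset_iff)
    have IH: "\<phi> ?c' = formal_eval A Q ?\<delta> ?c'" by (rule insert.IH[OF TS c'T c'])
    have dec: "c = ?c' \<oplus>\<^bsub>?F\<^esub> (c s \<odot>\<^bsub>?F\<^esub> free_gen A s)"
      by (rule ext) (simp add: free_module_def free_gen_def cF)
    have split: "\<psi> c = \<psi> ?c' \<oplus>\<^bsub>Q\<^esub> c s \<odot>\<^bsub>Q\<^esub> \<psi> (free_gen A s)"
      if \<psi>: "linear_map A ?F Q \<psi>" for \<psi>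
    proof -
      have "\<psi> (?c' \<oplus>\<^bsub>?F\<^esub> (c s \<odot>\<^bsub>?F\<^esub> free_gen A s)) =
          \<psi> ?c' \<oplus>\<^bsub>Q\<^esub> \<psi> (c s \<odot>\<^bsub>?F\<^esub> free_gen A s)"
        using \<psi> c' F.smult_closed[OF cF g[OF s]] unfolding linear_map_def by blast
      moreover have "\<psi> (c s \<odot>\<^bsub>?F\<^esub> free_gen A s) = c s \<odot>\<^bsub>Q\<^esub> \<psi> (free_gen A s)"
        using \<psi> cF g[OF s] unfolding linear_map_def by blast
      ultimately show ?thesis unfolding dec[symmetric] by simp
    qed
    show ?case
      unfolding split[OF \<phi>] split[OF lin] IH formal_eval_gen[OF assms(1) \<delta> s] ..
  qed
  moreover have "finite {i. c i \<noteq> \<zero>\<^bsub>A\<^esub>}" "{i. c i \<noteq> \<zero>\<^bsub>A\<^esub>} \<subseteq> S"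
    using c unfolding free_module_def by simp_all
  ultimately show ?thesis using c by blast
qed

context algebra
begin

context
  fixes Q and \<delta>
  assumes Q: "module M Q" and \<delta>: "derivation R M Q \<delta>"
begin

interpretation Q: module M Q by (rule Q)
interpretation F: module M kF by (rule kF_module)
interpretation N: abelian_subgroup kN kF by (rule F.submodule_abelian_subgroup[OF kN_submodule])

lemma formal_eval_kN:
  assumes "c \<in> kN"
  shows "formal_eval M Q \<delta> c = \<zero>\<^bsub>Q\<^esub>"
proof -
  let ?\<phi> = "formal_eval M Q \<delta>"
  have d: "\<delta> \<in> carrier M \<rightarrow> carrier Q"
    using \<delta> by (auto simp: derivation_def linear_map_def restrict_scalars_def)
  note lin = formal_eval_linear[OF Q d]
  note minus = linear_map_minus[OF kF_module Q lin]
  note gen = formal_eval_gen[OF Q d]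
  note [simp] = free_gen_closed[OF M_cring]
  have dc[simp]: "\<delta> f \<in> carrier Q" if "f \<in> carrier M" for f using d that by blast
  have 0: "x \<ominus>\<^bsub>Q\<^esub> x = \<zero>\<^bsub>Q\<^esub>" if "x \<in> carrier Q" for x using that by (simp add: Q.M.minus_eq Q.M.r_neg)
  let ?K = "{c \<in> carrier kF. ?\<phi> c = \<zero>\<^bsub>Q\<^esub>}"
  have add: "?\<phi> (x \<oplus>\<^bsub>kF\<^esub> y) = ?\<phi> x \<oplus>\<^bsub>Q\<^esub> ?\<phi> y" if "x \<in> carrier kF" "y \<in> carrier kF" for x y
    using lin that by (simp add: linear_map_def)
  have sm: "?\<phi> (a \<odot>\<^bsub>kF\<^esub> x) = a \<odot>\<^bsub>Q\<^esub> ?\<phi> x" if "x \<in> carrier kF" "a \<in> carrier M" for x a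
    using lin that by (simp add: linear_map_def)
  have z: "?\<phi> \<zero>\<^bsub>kF\<^esub> = \<zero>\<^bsub>Q\<^esub>" by (simp add: formal_eval_def free_module_def)
  have "submodule ?K M kF"
  proof (rule F.submoduleI)
    fix a assume a: "a \<in> ?K"
    then have "?\<phi> (\<zero>\<^bsub>kF\<^esub> \<ominus>\<^bsub>kF\<^esub> a) = \<zero>\<^bsub>Q\<^esub>" using minus[of "\<zero>\<^bsub>kF\<^esub>" a] z 0 by simp
    then show "\<ominus>\<^bsub>kF\<^esub> a \<in> ?K" using a by (simp add: F.M.minus_eq)
  qed (auto simp: z add sm)
  moreover have "kaehler_relations R M \<subseteq> ?K"
    using \<delta> unfolding kaehler_relations_def Let_def
    by (auto simp: minus add sm gen derivation_def linear_map_def restrict_scalars_def 0)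
  ultimately have "kN \<subseteq> ?K" unfolding kaehler_submodule_def submodule_span_def by blast
  then show ?thesis using assms by blast
qed

lemma kaehler_lift_coset:
  assumes "c \<in> carrier kF"
  shows "kaehler_lift M Q \<delta> (kN +>\<^bsub>kF\<^esub> c) = formal_eval M Q \<delta> c"
proof -
  have d: "\<delta> \<in> carrier M \<rightarrow> carrier Q"
    using \<delta> by (auto simp: derivation_def linear_map_def restrict_scalars_def)
  note lin = formal_eval_linear[OF Q d]
  have c': "formal_eval M Q \<delta> x = formal_eval M Q \<delta> c" if x: "x \<in> kN +>\<^bsub>kF\<^esub> c" for x
  proof -
    obtain n where n: "n \<in> kN" "x = n \<oplus>\<^bsub>kF\<^esub> c" using x by (auto simp: a_r_coset_def r_coset_def)
    then have "formal_eval M Q \<delta> x = formal_eval M Q \<delta> n \<oplus>\<^bsub>Q\<^esub> formal_eval M Q \<delta> c"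
      using lin assms N.a_Hcarr by (auto simp: linear_map_def)
    moreover have "formal_eval M Q \<delta> c \<in> carrier Q" using lin assms by (auto simp: linear_map_def)
    ultimately show ?thesis using formal_eval_kN n by simp
  qed
  have "c \<in> kN +>\<^bsub>kF\<^esub> c" using N.a_rcos_self assms by blast
  then show ?thesis unfolding kaehler_lift_def using c' by (intro the_equality) (metis, metis)
qed

theorem kaehler_lift_linear: "linear_map M (kaehler R M) Q (kaehler_lift M Q \<delta>)"
proof -
  have d: "\<delta> \<in> carrier M \<rightarrow> carrier Q"
    using \<delta> by (auto simp: derivation_def linear_map_def restrict_scalars_def)
  note lin = formal_eval_linear[OF Q d]
  have lift: "kaehler_lift M Q \<delta> (kN +>\<^bsub>kF\<^esub> c) = formal_eval M Q \<delta> c"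
    if "c \<in> carrier kF" for c by (rule kaehler_lift_coset[OF that])
  have cl: "formal_eval M Q \<delta> x \<in> carrier Q"
    and sm: "\<And>a. a \<in> carrier M \<Longrightarrow>
      formal_eval M Q \<delta> (a \<odot>\<^bsub>kF\<^esub> x) = a \<odot>\<^bsub>Q\<^esub> formal_eval M Q \<delta> x"
    and ad: "\<And>y. y \<in> carrier kF \<Longrightarrow>
      formal_eval M Q \<delta> (x \<oplus>\<^bsub>kF\<^esub> y) = formal_eval M Q \<delta> x \<oplus>\<^bsub>Q\<^esub> formal_eval M Q \<delta> y"
    if "x \<in> carrier kF" for x
    using lin that unfolding linear_map_def by blast+
  have ob: "\<exists>c\<in>carrier kF. \<alpha> = kN +>\<^bsub>kF\<^esub> c" if "\<alpha> \<in> carrier (kaehler R M)" for \<alpha>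
    using that unfolding kaehler_def F.quotient_carrier[OF kN_submodule] .
  have qs: "a \<odot>\<^bsub>kaehler R M\<^esub> (kN +>\<^bsub>kF\<^esub> x) = kN +>\<^bsub>kF\<^esub> (a \<odot>\<^bsub>kF\<^esub> x)"
    if "a \<in> carrier M" "x \<in> carrier kF" for a x
    unfolding kaehler_def by (rule F.quotient_smult[OF kN_submodule that])
  have qa: "(kN +>\<^bsub>kF\<^esub> x) \<oplus>\<^bsub>kaehler R M\<^esub> (kN +>\<^bsub>kF\<^esub> y) = kN +>\<^bsub>kF\<^esub> (x \<oplus>\<^bsub>kF\<^esub> y)"
    if "x \<in> carrier kF" "y \<in> carrier kF" for x y
    unfolding kaehler_def by (rule F.quotient_add[OF kN_submodule that])
  show ?thesis
    unfolding linear_map_def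
  proof (intro conjI ballI Pi_I)
    fix \<alpha> assume "\<alpha> \<in> carrier (kaehler R M)"
    from ob[OF this] obtain c where c: "c \<in> carrier kF" and \<alpha>: "\<alpha> = kN +>\<^bsub>kF\<^esub> c" ..
    show "kaehler_lift M Q \<delta> \<alpha> \<in> carrier Q"
      unfolding \<alpha> lift[OF c] by (rule cl[OF c])
  next
    fix a \<alpha> assume a: "a \<in> carrier M" and "\<alpha> \<in> carrier (kaehler R M)"
    from ob[OF this(2)] obtain c where c: "c \<in> carrier kF" and \<alpha>: "\<alpha> = kN +>\<^bsub>kF\<^esub> c" ..
    show "kaehler_lift M Q \<delta> (a \<odot>\<^bsub>kaehler R M\<^esub> \<alpha>) = a \<odot>\<^bsub>Q\<^esub> kaehler_lift M Q \<delta> \<alpha>"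
      unfolding \<alpha> qs[OF a c] lift[OF c] lift[OF F.smult_closed[OF a c]] by (rule sm[OF c a])
  next
    fix \<alpha> \<beta> assume ab: "\<alpha> \<in> carrier (kaehler R M)" "\<beta> \<in> carrier (kaehler R M)"
    from ob[OF ab(1)] obtain c where c: "c \<in> carrier kF" and \<alpha>: "\<alpha> = kN +>\<^bsub>kF\<^esub> c" ..
    from ob[OF ab(2)] obtain c' where c': "c' \<in> carrier kF" and \<beta>: "\<beta> = kN +>\<^bsub>kF\<^esub> c'" ..
    show "kaehler_lift M Q \<delta> (\<alpha> \<oplus>\<^bsub>kaehler R M\<^esub> \<beta>) =
        kaehler_lift M Q \<delta> \<alpha> \<oplus>\<^bsub>Q\<^esub> kaehler_lift M Q \<delta> \<beta>"
      unfolding \<alpha> \<beta> qa[OF c c'] lift[OF c] lift[OF c'] lift[OF F.M.a_closed[OF c c']]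
      by (rule ad[OF c c'])
  qed
qed

theorem kaehler_lift_d:
  assumes "f \<in> carrier M"
  shows "kaehler_lift M Q \<delta> (kaehler_d R M f) = \<delta> f"
proof -
  have d: "\<delta> \<in> carrier M \<rightarrow> carrier Q"
    using \<delta> by (auto simp: derivation_def linear_map_def restrict_scalars_def)
  show ?thesis
    unfolding kaehler_d_def
    by (simp add: kaehler_lift_coset free_gen_closed[OF M_cring] assms formal_eval_gen[OF Q d])
qed

theorem kaehler_lift_unique:
  assumes \<phi>: "linear_map M (kaehler R M) Q \<phi>"
    and eq: "\<And>f. f \<in> carrier M \<Longrightarrow> \<phi> (kaehler_d R M f) = \<delta> f"
    and \<alpha>: "\<alpha> \<in> carrier (kaehler R M)"
  shows "\<phi> \<alpha> = kaehler_lift M Q \<delta> \<alpha>"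
proof -
  let ?\<pi> = "\<lambda>c. kN +>\<^bsub>kF\<^esub> c"
  note q = F.quotient_smult[OF kN_submodule] F.quotient_add[OF kN_submodule]
    and qc = F.quotient_carrier[OF kN_submodule]
  have comp: "linear_map M kF Q (\<lambda>c. \<psi> (?\<pi> c))" if \<psi>: "linear_map M (kaehler R M) Q \<psi>" for \<psi>
    unfolding linear_map_def
  proof (intro conjI ballI Pi_I)
    have cl: "?\<pi> c \<in> carrier (kaehler R M)" if "c \<in> carrier kF" for c
      using that by (auto simp: kaehler_def qc)
    show "\<psi> (?\<pi> c) \<in> carrier Q" if "c \<in> carrier kF" for c
      using \<psi> cl[OF that] by (auto simp: linear_map_def)
    show "\<psi> (?\<pi> (c \<oplus>\<^bsub>kF\<^esub> c')) = \<psi> (?\<pi> c) \<oplus>\<^bsub>Q\<^esub> \<psi> (?\<pi> c')"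
      if "c \<in> carrier kF" "c' \<in> carrier kF" for c c'
      using \<psi> cl[OF that(1)] cl[OF that(2)] that q(2)[of c c']
      unfolding linear_map_def kaehler_def by metis
    show "\<psi> (?\<pi> (a \<odot>\<^bsub>kF\<^esub> c)) = a \<odot>\<^bsub>Q\<^esub> \<psi> (?\<pi> c)"
      if "a \<in> carrier M" "c \<in> carrier kF" for a c
      using \<psi> cl[OF that(2)] that q(1)[of a c]
      unfolding linear_map_def kaehler_def by metis
  qed
  obtain c where c: "c \<in> carrier kF" "\<alpha> = ?\<pi> c" using \<alpha> by (auto simp: kaehler_def qc)
  have "formal_eval M Q (\<lambda>s. \<phi> (?\<pi> (free_gen M s))) c =
      formal_eval M Q (\<lambda>s. kaehler_lift M Q \<delta> (?\<pi> (free_gen M s))) c"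
    unfolding formal_eval_def
  proof (rule Q.M.finsum_cong')
    fix i assume "i \<in> {h. c h \<noteq> \<zero>\<^bsub>M\<^esub>}"
    then have i: "i \<in> carrier M" using c(1) by (auto simp: free_module_def)
    show "c i \<odot>\<^bsub>Q\<^esub> \<phi> (?\<pi> (free_gen M i)) = c i \<odot>\<^bsub>Q\<^esub> kaehler_lift M Q \<delta> (?\<pi> (free_gen M i))"
      using eq[OF i] kaehler_lift_d[OF i] by (simp add: kaehler_d_def)
  next
    have "c i \<in> carrier M" for i using c(1) by (auto simp: free_module_def)
    moreover have "kaehler_lift M Q \<delta> (?\<pi> (free_gen M i)) \<in> carrier Q" if "c i \<noteq> \<zero>\<^bsub>M\<^esub>" for i
    proof -
      have i: "i \<in> carrier M" using that c(1) by (auto simp: free_module_def)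
      show ?thesis
        using comp[OF kaehler_lift_linear] free_gen_closed[OF M_cring i]
        unfolding linear_map_def by blast
    qed
    ultimately show "(\<lambda>i. c i \<odot>\<^bsub>Q\<^esub> kaehler_lift M Q \<delta> (?\<pi> (free_gen M i))) \<in> {h. c h \<noteq> \<zero>\<^bsub>M\<^esub>} \<rightarrow> carrier Q"
      by auto
  qed simp
  then show ?thesis
    using linear_map_eq_gen[OF Q comp[OF \<phi>] c(1)]
      linear_map_eq_gen[OF Q comp[OF kaehler_lift_linear] c(1)] c(2) by simp
qed

end

end

lemma (in cring) self_module_module: "module R (self_module R)"
  by (intro moduleI cring_axioms abelian_groupI)
    (auto simp: self_module_def a_ac m_assoc l_distr r_distr
      intro: bexI[of _ "\<ominus> _"] l_neg)

theorem (in poisson_algebra) anchor_d: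
  assumes "h \<in> carrier A" "f \<in> carrier A"
  shows "anchor A br (kaehler_d R A h) f = br h f"
  unfolding anchor_def
  by (rule kaehler_lift_d[OF cring.self_module_module[OF M_cring] derivation_left[OF assms(2)] assms(1)])

theorem (in poisson_algebra) anchor_linear:
  assumes "f \<in> carrier A"
  shows "linear_map A (kaehler R A) (self_module A) (\<lambda>\<alpha>. anchor A br \<alpha> f)"
  unfolding anchor_def
  by (rule kaehler_lift_linear[OF cring.self_module_module[OF M_cring] derivation_left[OF assms]])

section \<open>Admissible Poisson algebras and their Poisson triples\<close>

definition semidirect ::
    "('r, 'a, _) module_scheme \<Rightarrow> ('a, 'm, _) module_scheme \<Rightarrow> ('r, 'a \<times> 'm) module"
    (infixl \<open>\<ltimes>\<close> 65) where
  "P0 \<ltimes> P1 =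
     \<lparr>carrier = carrier P0 \<times> carrier P1,
      mult = (\<lambda>(f, \<eta>) (g, \<xi>). (f \<otimes>\<^bsub>P0\<^esub> g, f \<odot>\<^bsub>P1\<^esub> \<xi> \<oplus>\<^bsub>P1\<^esub> g \<odot>\<^bsub>P1\<^esub> \<eta>)),
      one = (\<one>\<^bsub>P0\<^esub>, \<zero>\<^bsub>P1\<^esub>),
      zero = (\<zero>\<^bsub>P0\<^esub>, \<zero>\<^bsub>P1\<^esub>),
      add = (\<lambda>(f, \<eta>) (g, \<xi>). (f \<oplus>\<^bsub>P0\<^esub> g, \<eta> \<oplus>\<^bsub>P1\<^esub> \<xi>)),
      smult = (\<lambda>r (f, \<eta>). (r \<odot>\<^bsub>P0\<^esub> f, r \<odot>\<^bsub>restrict_scalars P0 P1\<^esub> \<eta>))\<rparr>"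

definition admissible_poisson_algebra ::
    "('r, _) ring_scheme \<Rightarrow> ('r, 'a, _) module_scheme \<Rightarrow> ('a \<Rightarrow> 'a \<Rightarrow> 'a) \<Rightarrow>
     ('a, 'm, _) module_scheme \<Rightarrow> ('a \<times> 'm \<Rightarrow> 'a \<times> 'm \<Rightarrow> 'a \<times> 'm) \<Rightarrow> bool" where
  "admissible_poisson_algebra R P0 br0 P1 br \<longleftrightarrow>
     poisson_algebra R P0 br0 \<and> faithful_module P0 P1 \<and>
     poisson_algebra R (P0 \<ltimes> P1) br \<and>
     (\<forall>p\<in>carrier (P0 \<ltimes> P1). \<forall>q\<in>carrier (P0 \<ltimes> P1). fst (br p q) = br0 (fst p) (fst q))"

definition contravariant_derivative ::
    "('r, _) ring_scheme \<Rightarrow> ('r, 'a, _) module_scheme \<Rightarrow> ('a \<Rightarrow> 'a \<Rightarrow> 'a) \<Rightarrow>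
     ('a, 'm, _) module_scheme \<Rightarrow> (('a \<Rightarrow> 'a) set \<Rightarrow> 'm \<Rightarrow> 'm) \<Rightarrow> bool" where
  "contravariant_derivative R P0 br0 P1 D \<longleftrightarrow>
     bilinear_map R (restrict_scalars P0 (kaehler R P0)) (restrict_scalars P0 P1)
       (restrict_scalars P0 P1) D \<and>
     (\<forall>f\<in>carrier P0. \<forall>\<alpha>\<in>carrier (kaehler R P0). \<forall>\<eta>\<in>carrier P1.
        D (f \<odot>\<^bsub>kaehler R P0\<^esub> \<alpha>) \<eta> = f \<odot>\<^bsub>P1\<^esub> D \<alpha> \<eta> \<and>
        D \<alpha> (f \<odot>\<^bsub>P1\<^esub> \<eta>) = f \<odot>\<^bsub>P1\<^esub> D \<alpha> \<eta> \<oplus>\<^bsub>P1\<^esub> anchor P0 br0 \<alpha> f \<odot>\<^bsub>P1\<^esub> \<eta>)"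

text \<open>
  \<open>(br1, D, K)\<close> is the Poisson triple of the bracket \<open>br\<close>. The compatibility conditions between
  the three components follow from the Jacobi identity for \<open>br\<close>.
\<close>

definition corresponding_triple ::
    "('r, _) ring_scheme \<Rightarrow> ('r, 'a, _) module_scheme \<Rightarrow> ('a \<Rightarrow> 'a \<Rightarrow> 'a) \<Rightarrow>
     ('a, 'm, _) module_scheme \<Rightarrow> ('a \<times> 'm \<Rightarrow> 'a \<times> 'm \<Rightarrow> 'a \<times> 'm) \<Rightarrow>
     ('m \<Rightarrow> 'm \<Rightarrow> 'm) \<Rightarrow> (('a \<Rightarrow> 'a) set \<Rightarrow> 'm \<Rightarrow> 'm) \<Rightarrow>
     (('a \<Rightarrow> 'a) set \<Rightarrow> ('a \<Rightarrow> 'a) set \<Rightarrow> 'm) \<Rightarrow> bool" where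
  "corresponding_triple R P0 br0 P1 br br1 D K \<longleftrightarrow>
     lie_algebra P0 P1 br1 \<and>
     contravariant_derivative R P0 br0 P1 D \<and>
     bilinear_map P0 (kaehler R P0) (kaehler R P0) P1 K \<and>
     (\<forall>\<alpha>\<in>carrier (kaehler R P0). \<forall>\<beta>\<in>carrier (kaehler R P0). K \<alpha> \<beta> = \<ominus>\<^bsub>P1\<^esub> K \<beta> \<alpha>) \<and>
     (\<forall>f\<in>carrier P0. \<forall>g\<in>carrier P0. \<forall>\<eta>\<in>carrier P1. \<forall>\<xi>\<in>carrier P1.
        br (f, \<eta>) (g, \<xi>) =
          (br0 f g,
           D (kaehler_d R P0 f) \<xi> \<ominus>\<^bsub>P1\<^esub> D (kaehler_d R P0 g) \<eta> \<oplus>\<^bsub>P1\<^esub> br1 \<eta> \<xi>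
             \<oplus>\<^bsub>P1\<^esub> K (kaehler_d R P0 f) (kaehler_d R P0 g)))"

definition triple_T ::
    "('r, _) ring_scheme \<Rightarrow> ('r, 'a, _) module_scheme \<Rightarrow> ('a, 'm, _) module_scheme \<Rightarrow>
     (('a \<Rightarrow> 'a) set \<Rightarrow> 'm \<Rightarrow> 'm) \<Rightarrow> (('a \<Rightarrow> 'a) set \<Rightarrow> ('a \<Rightarrow> 'a) set \<Rightarrow> 'm) \<Rightarrow> 'a \<times> 'm \<Rightarrow> 'a \<Rightarrow> 'm" where
  "triple_T R P0 P1 D K = (\<lambda>(h, \<eta>) g.
     K (kaehler_d R P0 h) (kaehler_d R P0 g) \<ominus>\<^bsub>P1\<^esub> D (kaehler_d R P0 g) \<eta>)"

definition ker_T ::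
    "('r, _) ring_scheme \<Rightarrow> ('r, 'a, _) module_scheme \<Rightarrow> ('a, 'm, _) module_scheme \<Rightarrow>
     (('a \<Rightarrow> 'a) set \<Rightarrow> 'm \<Rightarrow> 'm) \<Rightarrow> (('a \<Rightarrow> 'a) set \<Rightarrow> ('a \<Rightarrow> 'a) set \<Rightarrow> 'm) \<Rightarrow> ('a \<times> 'm) set" where
  "ker_T R P0 P1 D K =
     {p \<in> carrier (P0 \<ltimes> P1). \<forall>g\<in>carrier P0. triple_T R P0 P1 D K p g = \<zero>\<^bsub>P1\<^esub>}"

text \<open>The map of \<open>P0 \<ltimes> P1\<close> with matrix entries \<open>Xij\<close>, from \<open>Pj\<close> to \<open>Pi\<close>.\<close>

definition block_map ::
    "('r, 'a, _) module_scheme \<Rightarrow> ('a, 'm, _) module_scheme \<Rightarrow>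
     ('a \<Rightarrow> 'a) \<Rightarrow> ('m \<Rightarrow> 'a) \<Rightarrow> ('a \<Rightarrow> 'm) \<Rightarrow> ('m \<Rightarrow> 'm) \<Rightarrow> 'a \<times> 'm \<Rightarrow> 'a \<times> 'm" where
  "block_map P0 P1 X00 X01 X10 X11 =
     restrict (\<lambda>(f, \<eta>). (X00 f \<oplus>\<^bsub>P0\<^esub> X01 \<eta>, X10 f \<oplus>\<^bsub>P1\<^esub> X11 \<eta>)) (carrier (P0 \<ltimes> P1))"

definition triple_X ::
    "('r, _) ring_scheme \<Rightarrow> ('r, 'a, _) module_scheme \<Rightarrow> ('a \<Rightarrow> 'a \<Rightarrow> 'a) \<Rightarrow> ('a, 'm, _) module_scheme \<Rightarrow>
     ('m \<Rightarrow> 'm \<Rightarrow> 'm) \<Rightarrow> (('a \<Rightarrow> 'a) set \<Rightarrow> 'm \<Rightarrow> 'm) \<Rightarrow>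
     (('a \<Rightarrow> 'a) set \<Rightarrow> ('a \<Rightarrow> 'a) set \<Rightarrow> 'm) \<Rightarrow> 'a \<times> 'm \<Rightarrow> 'a \<times> 'm \<Rightarrow> 'a \<times> 'm" where
  "triple_X R P0 br0 P1 br1 D K = (\<lambda>(h, \<eta>).
     block_map P0 P1
       (br0 h)                      (\<lambda>_. \<zero>\<^bsub>P0\<^esub>)
       (triple_T R P0 P1 D K (h, \<eta>)) (\<lambda>\<xi>. D (kaehler_d R P0 h) \<xi> \<oplus>\<^bsub>P1\<^esub> br1 \<eta> \<xi>))"

definition preserves_P0 :: "('r, 'a, _) module_scheme \<Rightarrow> ('a, 'm, _) module_scheme \<Rightarrow>
    ('a \<times> 'm \<Rightarrow> 'a \<times> 'm) \<Rightarrow> bool" where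
  "preserves_P0 P0 P1 X \<longleftrightarrow> X ` (carrier P0 \<times> {\<zero>\<^bsub>P1\<^esub>}) \<subseteq> carrier P0 \<times> {\<zero>\<^bsub>P1\<^esub>}"

definition Ham_0 :: "('r, 'a, _) module_scheme \<Rightarrow> ('a, 'm, _) module_scheme \<Rightarrow>
    ('a \<times> 'm \<Rightarrow> 'a \<times> 'm \<Rightarrow> 'a \<times> 'm) \<Rightarrow> ('a \<times> 'm \<Rightarrow> 'a \<times> 'm) set" where
  "Ham_0 P0 P1 br = {X \<in> Ham (P0 \<ltimes> P1) br. preserves_P0 P0 P1 X}"

end

(* The Jacobi identity says exactly that p |-> {p, .} is a Lie algebra homomorphism into the
   derivations; its image Ham(P) inherits the Lie algebra axioms, and its kernel consists of the
   Casimir elements. The triple formula for the bracket identifies {h + eta, .} with the block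
   matrix X_{h + eta}; everything else is read off by evaluating X_{h + eta} on P0 + 0 and
   0 + P1, using that each D_alpha and ad_eta is additive and hence vanishes at 0. *)
theory Submission
  imports Defs
begin

section \<open>Linear maps and Lie algebras in general\<close>

lemma linear_map_zero:
  assumes "abelian_group M" "abelian_group N" "linear_map R M N \<phi>"
  shows "\<phi> \<zero>\<^bsub>M\<^esub> = \<zero>\<^bsub>N\<^esub>"
proof -
  interpret M: abelian_group M by fact
  interpret N: abelian_group N by fact
  have "\<phi> \<zero>\<^bsub>M\<^esub> \<in> carrier N" and "\<phi> (\<zero>\<^bsub>M\<^esub> \<oplus>\<^bsub>M\<^esub> \<zero>\<^bsub>M\<^esub>) = \<phi> \<zero>\<^bsub>M\<^esub> \<oplus>\<^bsub>N\<^esub> \<phi> \<zero>\<^bsub>M\<^esub>"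
    using assms(3) unfolding linear_map_def by blast+
  then show ?thesis
    by (metis M.r_zero M.zero_closed N.add.r_cancel_one')
qed

lemma linear_map_neg:
  assumes "abelian_group M" "abelian_group N" "linear_map R M N \<phi>" "x \<in> carrier M"
  shows "\<phi> (\<ominus>\<^bsub>M\<^esub> x) = \<ominus>\<^bsub>N\<^esub> \<phi> x"
proof -
  interpret M: abelian_group M by fact
  interpret N: abelian_group N by fact
  have c: "\<phi> x \<in> carrier N" "\<phi> (\<ominus>\<^bsub>M\<^esub> x) \<in> carrier N"
    using assms(3,4) unfolding linear_map_def by blast+
  have "\<phi> (\<ominus>\<^bsub>M\<^esub> x) \<oplus>\<^bsub>N\<^esub> \<phi> x = \<phi> (\<ominus>\<^bsub>M\<^esub> x \<oplus>\<^bsub>M\<^esub> x)"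
    using assms(3,4) by (simp add: linear_map_def)
  also have "\<dots> = \<zero>\<^bsub>N\<^esub>"
    using assms(4) by (simp add: M.l_neg linear_map_zero[OF assms(1-3)])
  finally show ?thesis using c by (metis N.minus_equality)
qed

text \<open>Sums, multiples, negatives and zero in the image all come from the same operation
  performed before applying \<open>\<phi>\<close>. Applied to \<open>hamiltonian A br\<close>, this
  makes the Hamiltonian derivations a submodule of all derivations.\<close>

lemma linear_map_image_submodule:
  assumes "module R M" "module R N" "linear_map R M N \<phi>"
  shows "submodule (\<phi> ` carrier M) R N"
proof -
  interpret M: module R M by fact
  interpret N: module R N by fact
  have add: "\<phi> (x \<oplus>\<^bsub>M\<^esub> y) = \<phi> x \<oplus>\<^bsub>N\<^esub> \<phi> y" if "x \<in> carrier M" "y \<in> carrier M" for x y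
    using assms(3) that by (simp add: linear_map_def)
  have smult: "\<phi> (r \<odot>\<^bsub>M\<^esub> x) = r \<odot>\<^bsub>N\<^esub> \<phi> x" if "r \<in> carrier R" "x \<in> carrier M" for r x
    using assms(3) that by (simp add: linear_map_def)
  have neg: "\<phi> (\<ominus>\<^bsub>M\<^esub> x) = \<ominus>\<^bsub>N\<^esub> \<phi> x" if "x \<in> carrier M" for x
    by (rule linear_map_neg[OF M.abelian_group_axioms N.abelian_group_axioms assms(3) that])
  have zero: "\<phi> \<zero>\<^bsub>M\<^esub> = \<zero>\<^bsub>N\<^esub>"
    by (rule linear_map_zero[OF M.abelian_group_axioms N.abelian_group_axioms assms(3)])
  show ?thesis
  proof (rule N.submoduleI)
    show "\<phi> ` carrier M \<subseteq> carrier N" using assms(3) by (auto simp: linear_map_def)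
    show "\<zero>\<^bsub>N\<^esub> \<in> \<phi> ` carrier M" using imageI[OF M.M.zero_closed, of \<phi>] by (simp add: zero)
  qed (auto simp: neg[symmetric] add[symmetric] smult[symmetric])
qed

lemma (in lie_algebra) br_closed [simp]:
  "\<lbrakk>x \<in> carrier L; y \<in> carrier L\<rbrakk> \<Longrightarrow> br x y \<in> carrier L"
  using bilinear unfolding bilinear_map_def linear_map_def by blast

lemma (in lie_algebra) br_add:
  assumes "x \<in> carrier L" "y \<in> carrier L" "z \<in> carrier L"
  shows "br (x \<oplus>\<^bsub>L\<^esub> y) z = br x z \<oplus>\<^bsub>L\<^esub> br y z" "br z (x \<oplus>\<^bsub>L\<^esub> y) = br z x \<oplus>\<^bsub>L\<^esub> br z y"
  using bilinear assms by (simp_all add: bilinear_map_def linear_map_def)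

lemma (in lie_algebra) br_smult:
  assumes "r \<in> carrier R" "x \<in> carrier L" "z \<in> carrier L"
  shows "br (r \<odot>\<^bsub>L\<^esub> x) z = r \<odot>\<^bsub>L\<^esub> br x z" "br z (r \<odot>\<^bsub>L\<^esub> x) = r \<odot>\<^bsub>L\<^esub> br z x"
  using bilinear assms by (simp_all add: bilinear_map_def linear_map_def)

lemma (in lie_algebra) br_linear: "x \<in> carrier L \<Longrightarrow> linear_map R L L (br x)"
  using bilinear by (simp add: bilinear_map_def)

lemma (in lie_algebra) br_zero_right [simp]:
  "x \<in> carrier L \<Longrightarrow> br x \<zero>\<^bsub>L\<^esub> = \<zero>\<^bsub>L\<^esub>"
  by (rule linear_map_zero[OF M.abelian_group_axioms M.abelian_group_axioms br_linear])

lemma (in lie_algebra) br_neg_right: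
  "\<lbrakk>x \<in> carrier L; y \<in> carrier L\<rbrakk> \<Longrightarrow> br x (\<ominus>\<^bsub>L\<^esub> y) = \<ominus>\<^bsub>L\<^esub> br x y"
  by (rule linear_map_neg[OF M.abelian_group_axioms M.abelian_group_axioms br_linear])

text \<open>Polarization: expand \<open>br (x + y) (x + y) = 0\<close> by biadditivity. The diagonal
  terms vanish by \<open>alternating\<close>, which leaves
  \<open>br x y + br y x = 0\<close>.\<close>

lemma (in lie_algebra) br_skew:
  assumes "x \<in> carrier L" "y \<in> carrier L"
  shows "br x y = \<ominus>\<^bsub>L\<^esub> br y x"
proof -
  have "br x y \<oplus>\<^bsub>L\<^esub> br y x = br x (x \<oplus>\<^bsub>L\<^esub> y) \<oplus>\<^bsub>L\<^esub> br y (x \<oplus>\<^bsub>L\<^esub> y)"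
    using assms by (simp add: br_add alternating)
  also have "\<dots> = br (x \<oplus>\<^bsub>L\<^esub> y) (x \<oplus>\<^bsub>L\<^esub> y)" using assms by (simp add: br_add M.a_ac)
  also have "\<dots> = \<zero>\<^bsub>L\<^esub>" using assms by (simp add: alternating)
  finally show ?thesis using assms by (metis M.minus_equality br_closed)
qed

text \<open>This is the Jacobi identity in the form "ad of a bracket is the commutator of the ads".
  Skew-symmetry moves \<open>z\<close> to the last slot in each term of the cyclic form, at the cost
  of two signs.\<close>

lemma (in lie_algebra) br_br_left:
  assumes "x \<in> carrier L" "y \<in> carrier L" "z \<in> carrier L"
  shows "br (br x y) z = br x (br y z) \<ominus>\<^bsub>L\<^esub> br y (br x z)"
proof -
  have "br y (br z x) = \<ominus>\<^bsub>L\<^esub> br y (br x z)"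
    using assms br_skew[of z x] by (simp add: br_neg_right)
  moreover have "br z (br x y) = \<ominus>\<^bsub>L\<^esub> br (br x y) z"
    using assms by (intro br_skew) auto
  ultimately have "(br x (br y z) \<ominus>\<^bsub>L\<^esub> br y (br x z)) \<oplus>\<^bsub>L\<^esub> \<ominus>\<^bsub>L\<^esub> br (br x y) z = \<zero>\<^bsub>L\<^esub>"
    using jacobi[OF assms] by (simp add: M.minus_eq)
  \<comment> \<open>Uniqueness of additive inverses equates the difference with the double negative
    of \<open>br (br x y) z\<close>.\<close>
  from M.minus_equality[OF this] show ?thesis using assms by simp
qed

text \<open>Every element of \<open>L'\<close> is some \<open>\<phi> x\<close>, so each Lie axiom
  for \<open>br'\<close> is the image under \<open>\<phi>\<close> of the same axiom for
  \<open>br\<close>. For the Hamiltonian derivations this replaces a direct verification that the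
  commutator satisfies the axioms, its closure included.\<close>

lemma lie_hom_surj_lie_algebra:
  assumes "lie_algebra R L br" "module R L'" "lie_hom R L br L' br' \<phi>"
    and surj: "\<phi> ` carrier L = carrier L'"
  shows "lie_algebra R L' br'"
proof -
  interpret L: lie_algebra R L br by fact
  interpret L': module R L' by fact
  have lin: "linear_map R L L' \<phi>"
    and br: "\<And>x y. \<lbrakk>x \<in> carrier L; y \<in> carrier L\<rbrakk> \<Longrightarrow> br' (\<phi> x) (\<phi> y) = \<phi> (br x y)"
    using assms(3) by (auto simp: lie_hom_def)
  \<comment> \<open>Both rules are oriented so that rewriting pulls the operations of
    \<open>L'\<close> inside \<open>\<phi>\<close>, where the axioms of \<open>L\<close>
    apply.\<close>
  have add: "\<phi> x \<oplus>\<^bsub>L'\<^esub> \<phi> y = \<phi> (x \<oplus>\<^bsub>L\<^esub> y)" if "x \<in> carrier L" "y \<in> carrier L" for x y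
    using lin that by (simp add: linear_map_def)
  have smult: "r \<odot>\<^bsub>L'\<^esub> \<phi> x = \<phi> (r \<odot>\<^bsub>L\<^esub> x)" if "r \<in> carrier R" "x \<in> carrier L" for r x
    using lin that by (simp add: linear_map_def)
  have zero: "\<phi> \<zero>\<^bsub>L\<^esub> = \<zero>\<^bsub>L'\<^esub>"
    by (rule linear_map_zero[OF L.M.abelian_group_axioms L'.M.abelian_group_axioms lin])
  show ?thesis
  proof
    show "bilinear_map R L' L' L' br'"
      unfolding bilinear_map_def linear_map_def surj[symmetric]
      by (auto simp: br add smult L.br_add L.br_smult)
    show "br' x x = \<zero>\<^bsub>L'\<^esub>" if "x \<in> carrier L'" for x
      using that unfolding surj[symmetric] by (auto simp: br L.alternating zero)
    show "br' x (br' y z) \<oplus>\<^bsub>L'\<^esub> br' y (br' z x) \<oplus>\<^bsub>L'\<^esub> br' z (br' x y) = \<zero>\<^bsub>L'\<^esub>"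
      if "x \<in> carrier L'" "y \<in> carrier L'" "z \<in> carrier L'" for x y z
      using that unfolding surj[symmetric] by (auto simp: br add L.jacobi zero)
  qed
qed

text \<open>Being a homomorphism depends only on values on the carrier. This transfers the property
  from \<open>p \<mapsto> {p, .}\<close> to the map given by block matrices.\<close>

lemma (in lie_algebra) lie_hom_cong:
  assumes "lie_hom R L br L' br' \<phi>" "\<And>x. x \<in> carrier L \<Longrightarrow> \<phi> x = \<psi> x"
  shows "lie_hom R L br L' br' \<psi>"
  using assms by (simp add: lie_hom_def linear_map_def Pi_iff)

section \<open>The module of derivations of an algebra\<close>

lemma (in algebra) derivation_self_iff:
  "derivation R M (self_module M) \<delta> \<longleftrightarrow>
     \<delta> \<in> carrier M \<rightarrow> carrier M \<and>
     (\<forall>x\<in>carrier M. \<forall>y\<in>carrier M. \<delta> (x \<oplus>\<^bsub>M\<^esub> y) = \<delta> x \<oplus>\<^bsub>M\<^esub> \<delta> y) \<and>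
     (\<forall>r\<in>carrier R. \<forall>x\<in>carrier M. \<delta> (r \<odot>\<^bsub>M\<^esub> x) = r \<odot>\<^bsub>M\<^esub> \<delta> x) \<and>
     (\<forall>x\<in>carrier M. \<forall>y\<in>carrier M. \<delta> (x \<otimes>\<^bsub>M\<^esub> y) = x \<otimes>\<^bsub>M\<^esub> \<delta> y \<oplus>\<^bsub>M\<^esub> y \<otimes>\<^bsub>M\<^esub> \<delta> x)"
proof -
  \<comment> \<open>For \<open>M\<close> as a module over itself, restricting scalars along
    \<open>r \<mapsto> r 1\<close> gives back the original action of \<open>R\<close>.\<close>
  have "(r \<odot>\<^bsub>M\<^esub> \<one>\<^bsub>M\<^esub>) \<otimes>\<^bsub>M\<^esub> x = r \<odot>\<^bsub>M\<^esub> x" if "r \<in> carrier R" "x \<in> carrier M" for r x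
    using that by (simp add: smult_assoc2)
  then show ?thesis
    by (auto simp: derivation_def linear_map_def self_module_def restrict_scalars_def Pi_iff)
qed

lemma (in algebra) smult_assoc2':
  assumes "a \<in> carrier R" "x \<in> carrier M" "y \<in> carrier M"
  shows "x \<otimes>\<^bsub>M\<^esub> (a \<odot>\<^bsub>M\<^esub> y) = a \<odot>\<^bsub>M\<^esub> (x \<otimes>\<^bsub>M\<^esub> y)"
  using smult_assoc2[OF assms(1,3,2)] assms by (simp add: m_comm)

lemma (in algebra) der_algebra_module: "module R (der_algebra R M)"
proof -
  let ?D = "der_algebra R M"
  have S: "carrier ?D = {X \<in> extensional (carrier M). derivation R M (self_module M) X}"
    "X \<oplus>\<^bsub>?D\<^esub> Y = (\<lambda>a\<in>carrier M. X a \<oplus>\<^bsub>M\<^esub> Y a)" "r \<odot>\<^bsub>?D\<^esub> X = (\<lambda>a\<in>carrier M. r \<odot>\<^bsub>M\<^esub> X a)"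
    "\<zero>\<^bsub>?D\<^esub> = (\<lambda>a\<in>carrier M. \<zero>\<^bsub>M\<^esub>)" for X Y r
    by (simp_all add: der_algebra_def)
  have cl: "X a \<in> carrier M" if "X \<in> carrier ?D" "a \<in> carrier M" for X a
    using that by (auto simp: S derivation_self_iff)
  have add: "X \<oplus>\<^bsub>?D\<^esub> Y \<in> carrier ?D" if XY: "X \<in> carrier ?D" "Y \<in> carrier ?D" for X Y
    using that cl[OF XY(1)] cl[OF XY(2)]
    by (auto simp: S derivation_self_iff smult_r_distr M.a_ac r_distr)
  \<comment> \<open>Linearity of \<open>r X\<close> over \<open>R\<close> rests on commutativity of
    \<open>R\<close>; its Leibniz rule rests on scalars passing through either factor of a
    product.\<close>
  have smult: "r \<odot>\<^bsub>?D\<^esub> X \<in> carrier ?D" if rX: "r \<in> carrier R" "X \<in> carrier ?D" for r X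
    using that cl[OF rX(2)]
    by (auto simp: S derivation_self_iff smult_r_distr smult_assoc2' smult_assoc1[symmetric] R.m_comm)
  have ext: "X = Y" if "X \<in> extensional (carrier M)" "Y \<in> extensional (carrier M)"
    "\<And>a. a \<in> carrier M \<Longrightarrow> X a = Y a" for X Y
    using that by (rule extensionalityI)
  have "abelian_group ?D"
  proof (rule abelian_groupI)
    show "\<zero>\<^bsub>?D\<^esub> \<in> carrier ?D" by (simp add: S derivation_self_iff)
    fix X assume X: "X \<in> carrier ?D"
    show "\<zero>\<^bsub>?D\<^esub> \<oplus>\<^bsub>?D\<^esub> X = X"
      by (rule ext) (use X cl[OF X] in \<open>auto simp: S\<close>)
    show "\<exists>Y\<in>carrier ?D. Y \<oplus>\<^bsub>?D\<^esub> X = \<zero>\<^bsub>?D\<^esub>"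
    proof
      \<comment> \<open>The additive inverse is taken to be \<open>(-1) X\<close>, which is a
        derivation by the closure under scalars just shown.\<close>
      show "(\<ominus>\<^bsub>R\<^esub> \<one>\<^bsub>R\<^esub>) \<odot>\<^bsub>?D\<^esub> X \<in> carrier ?D" using X by (intro smult) auto
      show "(\<ominus>\<^bsub>R\<^esub> \<one>\<^bsub>R\<^esub>) \<odot>\<^bsub>?D\<^esub> X \<oplus>\<^bsub>?D\<^esub> X = \<zero>\<^bsub>?D\<^esub>"
        by (rule ext) (use cl[OF X] in \<open>auto simp: S smult_l_minus M.l_neg\<close>)
    qed
  next
    fix X Y assume XY: "X \<in> carrier ?D" "Y \<in> carrier ?D"
    show "X \<oplus>\<^bsub>?D\<^esub> Y \<in> carrier ?D" by (rule add[OF XY])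
    show "X \<oplus>\<^bsub>?D\<^esub> Y = Y \<oplus>\<^bsub>?D\<^esub> X"
      by (rule ext) (use cl[OF XY(1)] cl[OF XY(2)] in \<open>auto simp: S M.a_comm\<close>)
    fix Z assume Z: "Z \<in> carrier ?D"
    show "(X \<oplus>\<^bsub>?D\<^esub> Y) \<oplus>\<^bsub>?D\<^esub> Z = X \<oplus>\<^bsub>?D\<^esub> (Y \<oplus>\<^bsub>?D\<^esub> Z)"
      by (rule ext) (use cl[OF XY(1)] cl[OF XY(2)] cl[OF Z] in \<open>auto simp: S M.a_assoc\<close>)
  qed
  then show ?thesis
  proof (rule moduleI[OF R_cring])
    fix a X assume a: "a \<in> carrier R" and X: "X \<in> carrier ?D"
    show "a \<odot>\<^bsub>?D\<^esub> X \<in> carrier ?D" by (rule smult[OF a X])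
    show "(a \<oplus>\<^bsub>R\<^esub> b) \<odot>\<^bsub>?D\<^esub> X = a \<odot>\<^bsub>?D\<^esub> X \<oplus>\<^bsub>?D\<^esub> b \<odot>\<^bsub>?D\<^esub> X" if "b \<in> carrier R" for b
      by (rule ext) (use a that cl[OF X] in \<open>auto simp: S smult_l_distr\<close>)
    show "a \<odot>\<^bsub>?D\<^esub> (X \<oplus>\<^bsub>?D\<^esub> Y) = a \<odot>\<^bsub>?D\<^esub> X \<oplus>\<^bsub>?D\<^esub> a \<odot>\<^bsub>?D\<^esub> Y" if Y: "Y \<in> carrier ?D" for Y
      by (rule ext) (use a cl[OF X] cl[OF Y] in \<open>auto simp: S smult_r_distr\<close>)
    show "(a \<otimes>\<^bsub>R\<^esub> b) \<odot>\<^bsub>?D\<^esub> X = a \<odot>\<^bsub>?D\<^esub> (b \<odot>\<^bsub>?D\<^esub> X)" if "b \<in> carrier R" for b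
      by (rule ext) (use a that cl[OF X] in \<open>auto simp: S smult_assoc1\<close>)
  next
    fix X assume X: "X \<in> carrier ?D"
    show "\<one>\<^bsub>R\<^esub> \<odot>\<^bsub>?D\<^esub> X = X"
      by (rule ext) (use X cl[OF X] in \<open>auto simp: S\<close>)
  qed
qed

section \<open>Hamiltonian derivations of a Poisson algebra\<close>

context poisson_algebra
begin

lemma hamiltonian_linear: "linear_map R A (der_algebra R A) (hamiltonian A br)"
proof -
  have "hamiltonian A br p \<in> carrier (der_algebra R A)" if "p \<in> carrier A" for p
    using derivation_right[OF that]
    by (auto simp: hamiltonian_def der_algebra_def derivation_self_iff)
  then show ?thesis
    unfolding linear_map_def
    by (auto simp: hamiltonian_def der_algebra_def fun_eq_iff br_add br_smult)
qed

lemma Ham_submodule: "submodule (Ham A br) R (der_algebra R A)"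
  unfolding Ham_def
  by (rule linear_map_image_submodule[OF module_axioms der_algebra_module hamiltonian_linear])

lemma ham_algebra_module: "module R (ham_algebra R A br)"
  unfolding ham_algebra_def
  by (rule submodule.submodule_is_module[OF Ham_submodule der_algebra_module])

text \<open>This is \<open>br_br_left\<close> read at each point of the carrier. Both sides are
  \<open>undefined\<close> off the carrier, so they agree as functions.\<close>

lemma hamiltonian_br:
  assumes "p \<in> carrier A" "q \<in> carrier A"
  shows "hamiltonian A br (br p q) = commutator A (hamiltonian A br p) (hamiltonian A br q)"
  using assms by (auto simp: hamiltonian_def commutator_def fun_eq_iff br_br_left)

lemma hamiltonian_lie_hom:
  "lie_hom R A br (ham_algebra R A br) (commutator A) (hamiltonian A br)"
  using hamiltonian_linear
  by (auto simp: lie_hom_def linear_map_def ham_algebra_def Ham_def hamiltonian_br)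

lemma ham_algebra_lie_algebra: "lie_algebra R (ham_algebra R A br) (commutator A)"
  by (rule lie_hom_surj_lie_algebra[OF lie_algebra_axioms ham_algebra_module hamiltonian_lie_hom])
    (simp add: ham_algebra_def Ham_def)

lemma Ham_commutator_closed:
  "\<lbrakk>X \<in> Ham A br; Y \<in> Ham A br\<rbrakk> \<Longrightarrow> commutator A X Y \<in> Ham A br"
  by (auto simp: Ham_def hamiltonian_br[symmetric])

lemma Ham_lie_subalgebra: "lie_subalgebra (Ham A br) R (der_algebra R A) (commutator A)"
  by (simp add: lie_subalgebra_def Ham_submodule Ham_commutator_closed)

text \<open>The zero of \<open>ham_algebra\<close> is the zero map restricted to the carrier, so
  equality with it says exactly that \<open>br p\<close> vanishes on the carrier.\<close>

lemma hamiltonian_kernel: "a_kernel A (ham_algebra R A br) (hamiltonian A br) = casimirs A br"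
  by (auto simp: a_kernel_def' casimirs_def ham_algebra_def der_algebra_def hamiltonian_def
      fun_eq_iff)

end

section \<open>The block matrix of a Hamiltonian derivation\<close>

lemma restrict_scalars_simps [simp]:
  "carrier (restrict_scalars A M) = carrier M"
  "add (restrict_scalars A M) = add M"
  "r \<odot>\<^bsub>restrict_scalars A M\<^esub> x = (r \<odot>\<^bsub>A\<^esub> \<one>\<^bsub>A\<^esub>) \<odot>\<^bsub>M\<^esub> x"
  by (simp_all add: restrict_scalars_def)

lemma semidirect_simps [simp]:
  "carrier (P0 \<ltimes> P1) = carrier P0 \<times> carrier P1" "\<zero>\<^bsub>P0 \<ltimes> P1\<^esub> = (\<zero>\<^bsub>P0\<^esub>, \<zero>\<^bsub>P1\<^esub>)"
  "(f, \<eta>) \<oplus>\<^bsub>P0 \<ltimes> P1\<^esub> (g, \<xi>) = (f \<oplus>\<^bsub>P0\<^esub> g, \<eta> \<oplus>\<^bsub>P1\<^esub> \<xi>)"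
  "r \<odot>\<^bsub>P0 \<ltimes> P1\<^esub> (f, \<eta>) = (r \<odot>\<^bsub>P0\<^esub> f, (r \<odot>\<^bsub>P0\<^esub> \<one>\<^bsub>P0\<^esub>) \<odot>\<^bsub>P1\<^esub> \<eta>)"
  by (simp_all add: semidirect_def)

locale admissible_triple =
  fixes R :: "('r, 's) ring_scheme"
    and P0 :: "('r, 'a, 'b) module_scheme"
    and P1 :: "('a, 'm, 'c) module_scheme"
    and br0 br br1 D K
  assumes admissible: "admissible_poisson_algebra R P0 br0 P1 br"
    and triple: "corresponding_triple R P0 br0 P1 br br1 D K"
begin

sublocale P0: poisson_algebra R P0 br0
  using admissible by (simp add: admissible_poisson_algebra_def)

sublocale P: poisson_algebra R "P0 \<ltimes> P1" br
  using admissible by (simp add: admissible_poisson_algebra_def)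

sublocale P1: lie_algebra P0 P1 br1
  using triple by (simp add: corresponding_triple_def)

abbreviation "d \<equiv> kaehler_d R P0"
abbreviation "T \<equiv> triple_T R P0 P1 D K"
abbreviation "X \<equiv> triple_X R P0 br0 P1 br1 D K"
abbreviation "kerT \<equiv> ker_T R P0 P1 D K"

lemma d_closed [simp]: "f \<in> carrier P0 \<Longrightarrow> d f \<in> carrier (kaehler R P0)"
  using P0.kaehler_d_derivation by (auto simp: derivation_def linear_map_def)

text \<open>Linearity is over \<open>R\<close> only, hence the restricted scalars: over
  \<open>P0\<close> the second argument of \<open>D\<close> obeys a Leibniz rule with an anchor
  term.\<close>

lemma D_linear:
  "\<alpha> \<in> carrier (kaehler R P0) \<Longrightarrow>
     linear_map R (restrict_scalars P0 P1) (restrict_scalars P0 P1) (D \<alpha>)"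
  using triple
  by (simp add: corresponding_triple_def contravariant_derivative_def bilinear_map_def)

lemma D_closed [simp]:
  "\<lbrakk>\<alpha> \<in> carrier (kaehler R P0); \<xi> \<in> carrier P1\<rbrakk> \<Longrightarrow> D \<alpha> \<xi> \<in> carrier P1"
  using D_linear[of \<alpha>] by (simp add: linear_map_def Pi_iff)

lemma D_zero [simp]:
  assumes "\<alpha> \<in> carrier (kaehler R P0)"
  shows "D \<alpha> \<zero>\<^bsub>P1\<^esub> = \<zero>\<^bsub>P1\<^esub>"
proof -
  have "D \<alpha> (\<zero>\<^bsub>P1\<^esub> \<oplus>\<^bsub>P1\<^esub> \<zero>\<^bsub>P1\<^esub>) = D \<alpha> \<zero>\<^bsub>P1\<^esub> \<oplus>\<^bsub>P1\<^esub> D \<alpha> \<zero>\<^bsub>P1\<^esub>"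
    using D_linear[OF assms] unfolding linear_map_def restrict_scalars_simps by blast
  then show ?thesis
    using D_closed[OF assms P1.M.zero_closed] by (metis P1.M.add.r_cancel_one' P1.M.r_zero P1.M.zero_closed)
qed

lemma K_closed [simp]:
  "\<lbrakk>\<alpha> \<in> carrier (kaehler R P0); \<beta> \<in> carrier (kaehler R P0)\<rbrakk> \<Longrightarrow> K \<alpha> \<beta> \<in> carrier P1"
  using triple unfolding corresponding_triple_def bilinear_map_def linear_map_def by blast

lemma T_closed [simp]:
  "\<lbrakk>h \<in> carrier P0; \<eta> \<in> carrier P1; g \<in> carrier P0\<rbrakk> \<Longrightarrow> T (h, \<eta>) g \<in> carrier P1"
  by (simp add: triple_T_def)

lemma X_apply:
  assumes "h \<in> carrier P0" "g \<in> carrier P0" "\<xi> \<in> carrier P1"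
  shows "X (h, \<eta>) (g, \<xi>) = (br0 h g, T (h, \<eta>) g \<oplus>\<^bsub>P1\<^esub> (D (d h) \<xi> \<oplus>\<^bsub>P1\<^esub> br1 \<eta> \<xi>))"
  using assms by (simp add: triple_X_def block_map_def)

text \<open>The terms of the triple formula regroup by argument: \<open>K (d h) (d g)\<close> and
  \<open>- D (d g) \<eta>\<close> depend on \<open>g\<close> and form the corner entry
  \<open>T (h, \<eta>) g\<close>, while \<open>D (d h) \<xi>\<close> and
  \<open>br1 \<eta> \<xi>\<close> depend on \<open>\<xi>\<close> and form the lower diagonal
  entry.\<close>

lemma br_eq_X:
  assumes "h \<in> carrier P0" "\<eta> \<in> carrier P1" "g \<in> carrier P0" "\<xi> \<in> carrier P1"
  shows "br (h, \<eta>) (g, \<xi>) = X (h, \<eta>) (g, \<xi>)"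
proof -
  have "br (h, \<eta>) (g, \<xi>) = (br0 h g, D (d h) \<xi> \<ominus>\<^bsub>P1\<^esub> D (d g) \<eta> \<oplus>\<^bsub>P1\<^esub> br1 \<eta> \<xi> \<oplus>\<^bsub>P1\<^esub> K (d h) (d g))"
    using triple assms unfolding corresponding_triple_def by blast
  then show ?thesis
    using assms by (simp add: X_apply triple_T_def P1.M.minus_eq P1.M.a_ac)
qed

lemma hamiltonian_eq_X:
  assumes "p \<in> carrier (P0 \<ltimes> P1)"
  shows "hamiltonian (P0 \<ltimes> P1) br p = X p"
  using assms
  by (auto simp: hamiltonian_def fun_eq_iff br_eq_X triple_X_def block_map_def)

lemma Ham_eq_X: "Ham (P0 \<ltimes> P1) br = X ` carrier (P0 \<ltimes> P1)"
  unfolding Ham_def by (rule image_cong[OF refl hamiltonian_eq_X])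

lemma X_lie_hom:
  "lie_hom R (P0 \<ltimes> P1) br (ham_algebra R (P0 \<ltimes> P1) br) (commutator (P0 \<ltimes> P1)) X"
  by (rule P.lie_hom_cong[OF P.hamiltonian_lie_hom hamiltonian_eq_X])

lemma X_kernel:
  "a_kernel (P0 \<ltimes> P1) (ham_algebra R (P0 \<ltimes> P1) br) X = casimirs (P0 \<ltimes> P1) br"
  unfolding P.hamiltonian_kernel[symmetric] a_kernel_def'
  by (rule Collect_cong) (metis hamiltonian_eq_X)

section \<open>Casimir elements and preservation of \<open>P0\<close>\<close>

lemma X_P0:
  assumes "h \<in> carrier P0" "\<eta> \<in> carrier P1" "g \<in> carrier P0"
  shows "X (h, \<eta>) (g, \<zero>\<^bsub>P1\<^esub>) = (br0 h g, T (h, \<eta>) g)"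
  using assms by (simp add: X_apply)

lemma kerT_iff:
  "(h, \<eta>) \<in> kerT \<longleftrightarrow>
     h \<in> carrier P0 \<and> \<eta> \<in> carrier P1 \<and> (\<forall>g\<in>carrier P0. T (h, \<eta>) g = \<zero>\<^bsub>P1\<^esub>)"
  by (auto simp: ker_T_def)

text \<open>A block matrix vanishes iff its entries do. The first column is tested on
  \<open>(g, 0)\<close> and the second on \<open>(0, \<xi>)\<close>.\<close>

lemma casimir_iff:
  assumes k: "k \<in> carrier P0" and \<zeta>: "\<zeta> \<in> carrier P1"
  shows "(k, \<zeta>) \<in> casimirs (P0 \<ltimes> P1) br \<longleftrightarrow> k \<in> casimirs P0 br0 \<and> (k, \<zeta>) \<in> kerT \<and>
           (\<forall>\<xi>\<in>carrier P1. D (d k) \<xi> \<oplus>\<^bsub>P1\<^esub> br1 \<zeta> \<xi> = \<zero>\<^bsub>P1\<^esub>)" (is "?L \<longleftrightarrow> ?R")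
proof
  assume L: ?L
  have X: "X (k, \<zeta>) (g, \<xi>) = (\<zero>\<^bsub>P0\<^esub>, \<zero>\<^bsub>P1\<^esub>)" if "g \<in> carrier P0" "\<xi> \<in> carrier P1" for g \<xi>
    using L that k \<zeta> by (auto simp: casimirs_def br_eq_X)
  have T: "br0 k g = \<zero>\<^bsub>P0\<^esub>" "T (k, \<zeta>) g = \<zero>\<^bsub>P1\<^esub>" if "g \<in> carrier P0" for g
    using X[of g "\<zero>\<^bsub>P1\<^esub>"] that k \<zeta> by (simp_all add: X_P0)
  \<comment> \<open>At \<open>(0, \<xi>)\<close> the corner contributes
    \<open>T (k, \<zeta>) 0\<close>, which is zero by the previous fact, so only the lower diagonal
    entry survives.\<close>
  have "D (d k) \<xi> \<oplus>\<^bsub>P1\<^esub> br1 \<zeta> \<xi> = \<zero>\<^bsub>P1\<^esub>" if "\<xi> \<in> carrier P1" for \<xi>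
    using X[of "\<zero>\<^bsub>P0\<^esub>" \<xi>] that k \<zeta> by (simp add: X_apply T)
  with T k \<zeta> show ?R by (simp add: casimirs_def kerT_iff)
next
  assume ?R
  then show ?L using k \<zeta> by (auto simp: casimirs_def kerT_iff br_eq_X X_apply)
qed

text \<open>By \<open>X_P0\<close> the second component at \<open>(g, 0)\<close> is
  \<open>T (h, \<eta>) g\<close>, so preservation says that the corner entry vanishes on all of
  \<open>P0\<close>.\<close>

lemma preserves_P0_iff:
  assumes "h \<in> carrier P0" "\<eta> \<in> carrier P1"
  shows "preserves_P0 P0 P1 (X (h, \<eta>)) \<longleftrightarrow> (h, \<eta>) \<in> kerT"
  using assms by (auto simp: preserves_P0_def kerT_iff X_P0 image_subset_iff)

text \<open>Membership in \<open>kerT\<close> controls \<open>T\<close> on the carrier of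
  \<open>P0\<close> only. This suffices for equality of functions because \<open>block_map\<close>
  restricts to the carrier of \<open>P0 \<ltimes> P1\<close>.\<close>

lemma X_kerT:
  assumes "(h, \<eta>) \<in> kerT"
  shows "block_map P0 P1 (br0 h) (\<lambda>_. \<zero>\<^bsub>P0\<^esub>) (\<lambda>_. \<zero>\<^bsub>P1\<^esub>) (\<lambda>\<xi>. D (d h) \<xi> \<oplus>\<^bsub>P1\<^esub> br1 \<eta> \<xi>) = X (h, \<eta>)"
  using assms by (auto simp: triple_X_def block_map_def kerT_iff fun_eq_iff)

text \<open>Preservation is a property of the map alone, so by \<open>preserves_P0_iff\<close> it
  selects exactly the parameters in \<open>kerT\<close>. There the corner entry may be replaced by
  zero.\<close>

lemma Ham_0_eq:
  "Ham_0 P0 P1 br = {block_map P0 P1 (br0 h) (\<lambda>_. \<zero>\<^bsub>P0\<^esub>) (\<lambda>_. \<zero>\<^bsub>P1\<^esub>)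
      (\<lambda>\<xi>. D (d h) \<xi> \<oplus>\<^bsub>P1\<^esub> br1 \<eta> \<xi>) | h \<eta>. (h, \<eta>) \<in> kerT}" (is "_ = ?R")
proof -
  have "Ham_0 P0 P1 br = {X (h, \<eta>) | h \<eta>. (h, \<eta>) \<in> kerT}"
    unfolding Ham_0_def Ham_eq_X by (force simp: preserves_P0_iff kerT_iff)
  also have "\<dots> = ?R" by (metis (no_types, lifting) X_kerT)
  finally show ?thesis .
qed

text \<open>Maps sending \<open>P0 \<times> {0}\<close> into itself are closed under sums, multiples
  and composition, hence under commutators. The argument works with this invariance directly instead
  of with \<open>kerT\<close>.\<close>

lemma Ham_0_lie_subalgebra:
  "lie_subalgebra (Ham_0 P0 P1 br) R (ham_algebra R (P0 \<ltimes> P1) br) (commutator (P0 \<ltimes> P1))"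
proof -
  let ?P = "P0 \<ltimes> P1" and ?H = "ham_algebra R (P0 \<ltimes> P1) br"
  interpret H: module R ?H by (rule P.ham_algebra_module)
  have S: "carrier ?H = Ham ?P br" "Y \<oplus>\<^bsub>?H\<^esub> Z = (\<lambda>a\<in>carrier ?P. Y a \<oplus>\<^bsub>?P\<^esub> Z a)"
    "r \<odot>\<^bsub>?H\<^esub> Y = (\<lambda>a\<in>carrier ?P. r \<odot>\<^bsub>?P\<^esub> Y a)" "\<zero>\<^bsub>?H\<^esub> = (\<lambda>a\<in>carrier ?P. \<zero>\<^bsub>?P\<^esub>)" for Y Z r
    by (simp_all add: ham_algebra_def der_algebra_def)
  have Ham0: "Y \<in> Ham_0 P0 P1 br \<longleftrightarrow> Y \<in> carrier ?H \<and>
      (\<forall>g\<in>carrier P0. \<exists>f\<in>carrier P0. Y (g, \<zero>\<^bsub>P1\<^esub>) = (f, \<zero>\<^bsub>P1\<^esub>))" for Y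
    unfolding Ham_0_def preserves_P0_def S(1) by fastforce
  have smult: "r \<odot>\<^bsub>?H\<^esub> Y \<in> Ham_0 P0 P1 br" if r: "r \<in> carrier R" and Y: "Y \<in> Ham_0 P0 P1 br" for r Y
    unfolding Ham0
  proof (intro conjI ballI)
    show "r \<odot>\<^bsub>?H\<^esub> Y \<in> carrier ?H" using r Y by (simp add: Ham0)
    fix g assume g: "g \<in> carrier P0"
    then obtain f where "f \<in> carrier P0" "Y (g, \<zero>\<^bsub>P1\<^esub>) = (f, \<zero>\<^bsub>P1\<^esub>)" using Y Ham0 by blast
    with r g show "\<exists>f\<in>carrier P0. (r \<odot>\<^bsub>?H\<^esub> Y) (g, \<zero>\<^bsub>P1\<^esub>) = (f, \<zero>\<^bsub>P1\<^esub>)" by (simp add: S(3))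
  qed
  have "submodule (Ham_0 P0 P1 br) R ?H"
  proof (rule H.submoduleI)
    show "Ham_0 P0 P1 br \<subseteq> carrier ?H" using Ham0 by blast
    show "\<zero>\<^bsub>?H\<^esub> \<in> Ham_0 P0 P1 br" unfolding Ham0 using H.M.zero_closed by (auto simp: S(4))
    \<comment> \<open>Negation is multiplication by \<open>-1\<close>, so closure under scalars
      covers it.\<close>
    show "\<ominus>\<^bsub>?H\<^esub> Y \<in> Ham_0 P0 P1 br" if "Y \<in> Ham_0 P0 P1 br" for Y
      using smult[OF _ that, of "\<ominus>\<^bsub>R\<^esub> \<one>\<^bsub>R\<^esub>"] that by (simp add: H.smult_l_minus Ham0)
    show "Y \<oplus>\<^bsub>?H\<^esub> Z \<in> Ham_0 P0 P1 br" if Y: "Y \<in> Ham_0 P0 P1 br" and Z: "Z \<in> Ham_0 P0 P1 br" for Y Z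
      unfolding Ham0
    proof (intro conjI ballI)
      show "Y \<oplus>\<^bsub>?H\<^esub> Z \<in> carrier ?H" using Y Z by (simp add: Ham0)
      fix g assume g: "g \<in> carrier P0"
      then obtain f f' where "f \<in> carrier P0" "Y (g, \<zero>\<^bsub>P1\<^esub>) = (f, \<zero>\<^bsub>P1\<^esub>)"
        "f' \<in> carrier P0" "Z (g, \<zero>\<^bsub>P1\<^esub>) = (f', \<zero>\<^bsub>P1\<^esub>)" using Y Z Ham0 by meson
      with g show "\<exists>f\<in>carrier P0. (Y \<oplus>\<^bsub>?H\<^esub> Z) (g, \<zero>\<^bsub>P1\<^esub>) = (f, \<zero>\<^bsub>P1\<^esub>)" by (simp add: S(2))
    qed
  qed (rule smult)
  moreover have "commutator ?P Y Z \<in> Ham_0 P0 P1 br"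
    if Y: "Y \<in> Ham_0 P0 P1 br" and Z: "Z \<in> Ham_0 P0 P1 br" for Y Z
    unfolding Ham0
  proof (intro conjI ballI)
    show "commutator ?P Y Z \<in> carrier ?H" using Y Z by (simp add: Ham0 S(1) P.Ham_commutator_closed)
    fix g assume g: "g \<in> carrier P0"
    obtain f f' where f: "f \<in> carrier P0" "Y (g, \<zero>\<^bsub>P1\<^esub>) = (f, \<zero>\<^bsub>P1\<^esub>)"
      "f' \<in> carrier P0" "Z (g, \<zero>\<^bsub>P1\<^esub>) = (f', \<zero>\<^bsub>P1\<^esub>)" using g Y Z Ham0 by meson
    \<comment> \<open>The commutator at \<open>(g, 0)\<close> is
      \<open>Y (f', 0) - Z (f, 0)\<close>, so each map is applied once more, to the value of the
      other.\<close>
    obtain e e' where e: "e \<in> carrier P0" "Y (f', \<zero>\<^bsub>P1\<^esub>) = (e, \<zero>\<^bsub>P1\<^esub>)"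
      "e' \<in> carrier P0" "Z (f, \<zero>\<^bsub>P1\<^esub>) = (e', \<zero>\<^bsub>P1\<^esub>)" using f Y Z Ham0 by meson
    \<comment> \<open>Negation in \<open>P0 \<ltimes> P1\<close> is determined by addition, so its
      componentwise form is obtained from uniqueness of inverses.\<close>
    have "\<ominus>\<^bsub>?P\<^esub> (e', \<zero>\<^bsub>P1\<^esub>) = (\<ominus>\<^bsub>P0\<^esub> e', \<zero>\<^bsub>P1\<^esub>)"
      using e by (intro P.M.minus_equality) (auto simp: P0.M.l_neg)
    with e f g show "\<exists>f\<in>carrier P0. commutator ?P Y Z (g, \<zero>\<^bsub>P1\<^esub>) = (f, \<zero>\<^bsub>P1\<^esub>)"
      by (simp add: commutator_def P.M.minus_eq)
  qed
  ultimately show ?thesis by (simp add: lie_subalgebra_def)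
qed

end

theorem proposition7p10:
  fixes R :: "('r, 's) ring_scheme"
    and P0 :: "('r, 'a, 'b) module_scheme"
    and P1 :: "('a, 'm, 'c) module_scheme"
    and br0 :: "'a \<Rightarrow> 'a \<Rightarrow> 'a"
    and br :: "'a \<times> 'm \<Rightarrow> 'a \<times> 'm \<Rightarrow> 'a \<times> 'm"
    and br1 :: "'m \<Rightarrow> 'm \<Rightarrow> 'm"
    and D :: "('a \<Rightarrow> 'a) set \<Rightarrow> 'm \<Rightarrow> 'm"
    and K :: "('a \<Rightarrow> 'a) set \<Rightarrow> ('a \<Rightarrow> 'a) set \<Rightarrow> 'm"
  assumes "admissible_poisson_algebra R P0 br0 P1 br"
    and "corresponding_triple R P0 br0 P1 br br1 D K"
  shows "let P = P0 \<ltimes> P1;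
             X = triple_X R P0 br0 P1 br1 D K;
             kerT = ker_T R P0 P1 D K
    in
      lie_algebra R (ham_algebra R P br) (commutator P) \<and>
      lie_subalgebra (Ham P br) R (der_algebra R P) (commutator P) \<and>
      (\<forall>p\<in>carrier P. hamiltonian P br p = X p) \<and>
      Ham P br = {X (h, \<eta>) | h \<eta>. (h, \<eta>) \<in> carrier P} \<and>
      \<comment> \<open>(1)\<close>
      lie_hom R P br (ham_algebra R P br) (commutator P) X \<and>
      a_kernel P (ham_algebra R P br) X = casimirs P br \<and>
      casimirs P br =
        {(k, \<zeta>) | k \<zeta>. (k, \<zeta>) \<in> carrier P \<and> k \<in> casimirs P0 br0 \<and> (k, \<zeta>) \<in> kerT \<and>
           (\<forall>\<xi>\<in>carrier P1. D (kaehler_d R P0 k) \<xi> \<oplus>\<^bsub>P1\<^esub> br1 \<zeta> \<xi> = \<zero>\<^bsub>P1\<^esub>)} \<and>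
      \<comment> \<open>(2)\<close>
      (\<forall>h \<eta>. (h, \<eta>) \<in> carrier P \<longrightarrow> (preserves_P0 P0 P1 (X (h, \<eta>)) \<longleftrightarrow> (h, \<eta>) \<in> kerT)) \<and>
      \<comment> \<open>(3)\<close>
      Ham_0 P0 P1 br =
        {block_map P0 P1
           (br0 h)        (\<lambda>_. \<zero>\<^bsub>P0\<^esub>)
           (\<lambda>_. \<zero>\<^bsub>P1\<^esub>)    (\<lambda>\<xi>. D (kaehler_d R P0 h) \<xi> \<oplus>\<^bsub>P1\<^esub> br1 \<eta> \<xi>) | h \<eta>. (h, \<eta>) \<in> kerT} \<and>
      lie_subalgebra (Ham_0 P0 P1 br) R (ham_algebra R P br) (commutator P)"
proof -
  interpret admissible_triple R P0 P1 br0 br br1 D K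
    by (rule admissible_triple.intro[OF assms])
  \<comment> \<open>Every Casimir element is thereby a pair with components in \<open>P0\<close> and
    \<open>P1\<close>, to which \<open>casimir_iff\<close> applies.\<close>
  have "casimirs (P0 \<ltimes> P1) br \<subseteq> carrier (P0 \<ltimes> P1)" by (auto simp: casimirs_def)
  then have casimirs: "casimirs (P0 \<ltimes> P1) br =
      {(k, \<zeta>) | k \<zeta>. (k, \<zeta>) \<in> carrier (P0 \<ltimes> P1) \<and> k \<in> casimirs P0 br0 \<and> (k, \<zeta>) \<in> kerT \<and>
         (\<forall>\<xi>\<in>carrier P1. D (d k) \<xi> \<oplus>\<^bsub>P1\<^esub> br1 \<zeta> \<xi> = \<zero>\<^bsub>P1\<^esub>)}"
    using casimir_iff by (auto; blast)
  have Ham: "Ham (P0 \<ltimes> P1) br = {X (h, \<eta>) | h \<eta>. (h, \<eta>) \<in> carrier (P0 \<ltimes> P1)}"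
    unfolding Ham_eq_X by auto
  have preserves: "\<forall>h \<eta>. (h, \<eta>) \<in> carrier (P0 \<ltimes> P1) \<longrightarrow>
      (preserves_P0 P0 P1 (X (h, \<eta>)) \<longleftrightarrow> (h, \<eta>) \<in> kerT)"
    by (simp add: preserves_P0_iff)
  show ?thesis
    unfolding Let_def
    by (intro conjI ballI P.ham_algebra_lie_algebra P.Ham_lie_subalgebra hamiltonian_eq_X Ham
        X_lie_hom X_kernel casimirs preserves Ham_0_eq Ham_0_lie_subalgebra)
qed

end
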